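(* Let $T\colon[0,1]\to[0,1]$ be a transitive piecewise monotonic map. If $\mu\in M_T^{\mathrm{erg}}([0,1])$ has positive metric entropy $h_\mu(T)>0$, then $\mu$ belongs to the weak-* closure of $M_T^{\mathrm{per}}([0,1])$.
   Context: A Borel measurable map $T\colon[0,1]\to[0,1]$ is a piecewise monotonic map if there exist an integer $N>1$ and points $0=c_0<c_1<\cdots<c_N=1$ such that, for each $1\le i\le N$, the restriction $T|_{(c_{i-1},c_i)}$ is strictly monotonic and continuous (no condition is imposed on the values of $T$ at the points $c_i$ beyond lying in $[0,1]$; $T$ need not be continuous). $T$ is transitive if there exists $x\in[0,1]$ whose forward orbit $\{T^nx : n\in\mathbb{N}\}$ is dense in $[0,1]$, where $\mathbb{N}$ is the set of non-negative integers. $M([0,1])$ is the set of Borel probability measures on $[0,1]$ with the weak-* topology, $M_T([0,1])\subset M([0,1])$ is the set of $T$-invariant ones, and $M_T^{\mathrm{erg}}([0,1])\subset M_T([0,1])$ is the set of $T$-ergodic invariant measures. $M_T^{\mathrm{per}}([0,1])$ is the set of periodic measures, i.e. measures of the form $\frac1n\sum_{j=0}^{n-1}\delta_{T^jp}$, where $p\in[0,1]$ is a periodic point of $T$ of period $n$ and $\delta_y$ is the Dirac measure at $y$. The metric entropy $h_\mu(T)$ is the Kolmogorov–Sinai entropy: $h_\mu(T)=\sup_\alpha \lim_{n\to\infty}\frac1n H_\mu\big(\bigvee_{i=0}^{n-1}T^{-i}\alpha\big)$, the supremum being over finite measurable partitions $\alpha$, where $H_\mu(\beta)=-\sum_{B\in\beta}\mu(B)\log\mu(B)$.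 *)

theory Defs
  imports "HOL-Probability.Probability"
begin

section \<open>Ergodic measures and Kolmogorov--Sinai entropy\<close>

definition measure_preserving :: "'a measure \<Rightarrow> ('a \<Rightarrow> 'a) \<Rightarrow> bool" where
  "measure_preserving M T \<longleftrightarrow> T \<in> M \<rightarrow>\<^sub>M M \<and> distr M M T = M"

definition ergodic :: "'a measure \<Rightarrow> ('a \<Rightarrow> 'a) \<Rightarrow> bool" where
  "ergodic M T \<longleftrightarrow>
     (\<forall>A\<in>sets M. T -` A \<inter> space M = A \<longrightarrow> measure M A = 0 \<or> measure M A = 1)"

definition finite_measurable_partition :: "'a measure \<Rightarrow> 'a set set \<Rightarrow> bool" where
  "finite_measurable_partition M P \<longleftrightarrow> finite P \<and> P \<subseteq> sets M \<and> partition_on (space M) P"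

text \<open>Library partitions consist of nonempty sets, so empty preimages are dropped; they would not
  contribute to the entropy.\<close>

definition preimage_partition :: "'a measure \<Rightarrow> ('a \<Rightarrow> 'a) \<Rightarrow> 'a set set \<Rightarrow> 'a set set" where
  "preimage_partition M f P = (\<lambda>A. f -` A \<inter> space M) ` P - {{}}"

definition iterated_join :: "'a measure \<Rightarrow> ('a \<Rightarrow> 'a) \<Rightarrow> 'a set set \<Rightarrow> nat \<Rightarrow> 'a set set" where
  "iterated_join M T P n = common_refinement ((\<lambda>i. preimage_partition M (T ^^ i) P) ` {..<n})"

definition partition_entropy :: "'a measure \<Rightarrow> 'a set set \<Rightarrow> real" where
  "partition_entropy M P = - (\<Sum>B\<in>P. measure M B * ln (measure M B))"

text \<open>The limit exists by subadditivity whenever \<open>T\<close> preserves the probability measure \<open>M\<close>.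
  The supremum may be infinite, hence the extended reals.\<close>

definition metric_entropy :: "'a measure \<Rightarrow> ('a \<Rightarrow> 'a) \<Rightarrow> ereal" where
  "metric_entropy M T =
     (SUP P\<in>{P. finite_measurable_partition M P}.
        ereal (lim (\<lambda>n. partition_entropy M (iterated_join M T P n) / real n)))"

section \<open>Maps and measures on the unit interval\<close>

text \<open>A self-map of the unit interval is a function on the reals of which only the values on
  \<open>{0..1}\<close> matter.\<close>

abbreviation unit_borel :: "real measure" where
  "unit_borel \<equiv> restrict_space borel {0..1}"

definition piecewise_monotonic :: "(real \<Rightarrow> real) \<Rightarrow> bool" where
  "piecewise_monotonic T \<longleftrightarrow>
     T \<in> unit_borel \<rightarrow>\<^sub>M unit_borel \<and>
     (\<exists>(N::nat) (c::nat \<Rightarrow> real). N > 1 \<and> c 0 = 0 \<and> c N = 1 \<and>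
        (\<forall>i\<in>{1..N}. c (i - 1) < c i \<and>
           continuous_on {c (i - 1)<..<c i} T \<and>
           (strict_mono_on {c (i - 1)<..<c i} T \<or> strict_antimono_on {c (i - 1)<..<c i} T)))"

definition transitive_map :: "(real \<Rightarrow> real) \<Rightarrow> bool" where
  "transitive_map T \<longleftrightarrow> (\<exists>x\<in>{0..1}. {0..1} \<subseteq> closure {(T ^^ n) x |n. True})"

definition prob_measures :: "real measure set" where
  "prob_measures = {\<mu>. prob_space \<mu> \<and> sets \<mu> = sets unit_borel}"

text \<open>The coarsest topology on the Borel probability measures making all maps
  \<open>\<mu> \<mapsto> \<integral> f d\<mu>\<close> with \<open>f\<close> continuous on \<open>{0..1}\<close> continuous.\<close>

definition weak_star_topology :: "real measure topology" where
  "weak_star_topology = topology_generated_by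
     {{\<mu> \<in> prob_measures. integral\<^sup>L \<mu> f \<in> U} | (f :: real \<Rightarrow> real) U.
        continuous_on {0..1} f \<and> open U}"

definition invariant_measures :: "(real \<Rightarrow> real) \<Rightarrow> real measure set" where
  "invariant_measures T = {\<mu> \<in> prob_measures. measure_preserving \<mu> T}"

definition ergodic_measures :: "(real \<Rightarrow> real) \<Rightarrow> real measure set" where
  "ergodic_measures T = {\<mu> \<in> invariant_measures T. ergodic \<mu> T}"

text \<open>\<open>n\<close> need not be the least period: the average over a multiple of the least period is the
  same measure.\<close>

definition periodic_measures :: "(real \<Rightarrow> real) \<Rightarrow> real measure set" where
  "periodic_measures T =
     {\<mu> \<in> prob_measures. \<exists>p\<in>{0..1}. \<exists>n>0. (T ^^ n) p = p \<and>
        (\<forall>A\<in>sets \<mu>. measure \<mu> A =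
           1 / real n * (\<Sum>j<n. measure (return unit_borel ((T ^^ j) p)) A))}"

end

(*
  Code points by their position relative to a finite set S containing the cut points and so fine that
  the finitely many test functions in a weak-* neighbourhood of \<mu> are nearly constant on each
  code. The points with the same n-word as x form an interval C_n(x) on which T^n is continuous and injective. Fix m,
  and say that x splits at n if C_n(x) contains points with other (n+m)-words on both sides of x.
  Then T^n maps C_(n+m)(x) onto the m-cylinder of T^n x. If x splits infinitely often, two of these
  m-cylinders coincide, and the intermediate value theorem yields a periodic point shadowing a long
  orbit segment of x; when x is generic for \<mu> (Birkhoff), its periodic measure is close to \<mu>.
  Otherwise almost every x eventually never splits. If x does not split at n, then an end point of
  C_n(x) runs into S at some time k \<le> n, so that the rest of the word of x after time k is one of at
  most 3 |S| words. The number a_t of words of length t therefore satisfies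
  a_t \<le> 3 |S| (a_0 + ... + a_(t-m)), hence grows at a rate tending to 1 as m grows; comparing
  an arbitrary partition with the coding, every partition has entropy 0, contradicting positive
  entropy.
*)
theory Submission
  imports Defs
begin

subsection \<open>Birkhoff averages of ergodic measures\<close>

text \<open>The obstacle is that a repeated word alone closes no orbit: the image of
  \<open>C_n(x)\<close> under \<open>T ^^ n\<close> may be cut off by orbits of points of
  \<open>S\<close> before it reaches across the cylinder to which it returns. Splitting on both
  sides of \<open>x\<close> is what forces the image to cover a whole cylinder of the fixed depth
  \<open>m\<close>. The delay \<open>m\<close> also controls the opposite case. The factor
  \<open>3 * card S\<close> counts, for each point of \<open>S\<close>, its own word and two
  one-sided limit words, and does not depend on \<open>m\<close>. A rate \<theta> > 1 is therefore
  admissible once \<open>(\<theta> - 1) * \<theta> ^ m\<close> is at least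
  \<open>3 * card S * \<theta>\<close>, so \<open>m\<close> has to be chosen after \<open>S\<close>.
  No single coding is shown to generate. Instead \<open>S\<close> is chosen anew for each partition
  and each tolerance, so fine that the code determines the cell of the partition outside a set of
  small measure.\<close>

fun max_birkhoff_sum :: "('a \<Rightarrow> 'a) \<Rightarrow> ('a \<Rightarrow> real) \<Rightarrow> nat \<Rightarrow> 'a \<Rightarrow> real" where
  "max_birkhoff_sum T g 0 x = 0"
| "max_birkhoff_sum T g (Suc n) x = max 0 (g x + max_birkhoff_sum T g n (T x))"

lemma max_birkhoff_sum_nonneg: "0 \<le> max_birkhoff_sum T g n x"
  by (cases n) auto

lemma max_birkhoff_sum_mono_Suc: "max_birkhoff_sum T g n x \<le> max_birkhoff_sum T g (Suc n) x"
proof (induction n arbitrary: x)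
  case (Suc n)
  show ?case using Suc[of "T x"] by simp
qed simp

lemma birkhoff_sum_Suc:
  fixes g :: "'a \<Rightarrow> real"
  shows "(\<Sum>i<Suc n. g ((T ^^ i) x)) = g x + (\<Sum>i<n. g ((T ^^ i) (T x)))"
  by (subst sum.lessThan_Suc_shift) (simp add: funpow_swap1)

text \<open>The recursion unfolds to the largest Birkhoff sum of length 0 to \<open>n\<close>; the
  empty sum accounts for the \<open>max 0\<close>.\<close>

lemma birkhoff_sum_le_max: "k \<le> n \<Longrightarrow> (\<Sum>i<k. g ((T ^^ i) x)) \<le> max_birkhoff_sum T g n x"
proof (induction n arbitrary: k x)
  case (Suc n)
  show ?case
  proof (cases k)
    case (Suc k')
    have "(\<Sum>i<k'. g ((T ^^ i) (T x))) \<le> max_birkhoff_sum T g n (T x)"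
      using Suc.prems Suc by (intro Suc.IH) auto
    then show ?thesis unfolding Suc birkhoff_sum_Suc by simp
  qed simp
qed simp

lemma max_birkhoff_sum_measurable [measurable]:
  assumes [measurable]: "T \<in> M \<rightarrow>\<^sub>M M" "g \<in> borel_measurable M"
  shows "max_birkhoff_sum T g n \<in> borel_measurable M"
proof (induction n)
  case (Suc n)
  note Suc [measurable]
  show ?case by (simp add: fun_eq_iff[symmetric] cong: measurable_cong) measurable
qed simp

lemma abs_max_birkhoff_sum_le:
  assumes "\<And>x. \<bar>g x\<bar> \<le> C"
  shows "\<bar>max_birkhoff_sum T g n x\<bar> \<le> real n * C"
proof (induction n arbitrary: x)
  case (Suc n)
  show ?case using Suc[of "T x"] assms[of x] by (simp add: algebra_simps abs_le_iff max_def)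
qed simp

text \<open>Garsia's argument: \<open>max_birkhoff_sum T g (Suc n) x - max_birkhoff_sum T g n (T x)\<close> has
  nonnegative integral and is eventually equal to \<open>g x\<close>.\<close>

lemma integral_nonneg_of_unbounded_birkhoff_sums:
  fixes g :: "'a \<Rightarrow> real"
  assumes "prob_space M" and mp: "measure_preserving M T"
    and [measurable]: "g \<in> borel_measurable M" and C: "\<And>x. \<bar>g x\<bar> \<le> C"
    and unb: "AE x in M. \<not> bdd_above (range (\<lambda>n. \<Sum>i<n. g ((T ^^ i) x)))"
  shows "0 \<le> integral\<^sup>L M g"
proof -
  interpret prob_space M by fact
  have T [measurable]: "T \<in> M \<rightarrow>\<^sub>M M" and distr: "distr M M T = M"
    using mp by (auto simp: measure_preserving_def)
  let ?m = "max_birkhoff_sum T g"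
  have int: "integrable M (?m n)" for n
    using abs_max_birkhoff_sum_le[of g C T n, OF C]
    by (intro integrable_const_bound[where B = "real n * C"]) auto
  have int': "integrable M (\<lambda>x. ?m n (T x))" for n
    using abs_max_birkhoff_sum_le[of g C T n, OF C]
    by (intro integrable_const_bound[where B = "real n * C"]) auto
  define d where "d = (\<lambda>n x. ?m (Suc n) x - ?m n (T x))"
  \<comment> \<open>In this form \<open>d n x\<close> lies between \<open>g x\<close> and
    \<open>max 0 (g x)\<close>, which gives the domination by \<open>C\<close>.\<close>
  have d_eq: "d n x = max (- ?m n (T x)) (g x)" for n x
    by (auto simp: d_def max_def)
  have d_bound: "\<bar>d n x\<bar> \<le> C" for n x
    using max_birkhoff_sum_nonneg[of T g n "T x"] C[of x] unfolding d_eq by (auto simp: max_def abs_le_iff)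
  have d_nonneg: "0 \<le> integral\<^sup>L M (d n)" for n
  proof -
    have "integral\<^sup>L M (\<lambda>x. ?m n (T x)) = integral\<^sup>L (distr M M T) (?m n)"
      by (simp add: integral_distr)
    also have "\<dots> = integral\<^sup>L M (?m n)" by (simp add: distr)
    also have "\<dots> \<le> integral\<^sup>L M (?m (Suc n))"
      by (intro integral_mono int max_birkhoff_sum_mono_Suc)
    finally show ?thesis unfolding d_def
      by (subst Bochner_Integration.integral_diff[OF int int']) simp
  qed
  have "(\<lambda>n. integral\<^sup>L M (d n)) \<longlonglongrightarrow> integral\<^sup>L M g"
  proof (rule integral_dominated_convergence[where w = "\<lambda>_. C"])
    show "AE x in M. (\<lambda>n. d n x) \<longlonglongrightarrow> g x"
      using unb
    proof eventually_elim
      case (elim x)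
      \<comment> \<open>Passing from \<open>x\<close> to \<open>T x\<close> removes the term
        \<open>g x\<close>, so a sum above twice \<open>\<bar>g x\<bar>\<close> at \<open>x\<close>
        leaves one above \<open>- g x\<close> at \<open>T x\<close>.\<close>
      then obtain k where k: "(\<Sum>i<k. g ((T ^^ i) x)) > \<bar>g x\<bar> + \<bar>g x\<bar>"
        unfolding bdd_above_def by (auto simp: not_le)
      then have "k \<noteq> 0" by (intro notI) auto
      then obtain k' where k': "k = Suc k'" by (cases k) auto
      have "d n x = g x" if "n \<ge> k'" for n
      proof -
        have "(\<Sum>i<k'. g ((T ^^ i) (T x))) \<le> ?m n (T x)"
          by (rule birkhoff_sum_le_max) fact
        then show ?thesis using k unfolding k' birkhoff_sum_Suc d_eq by (auto simp: max_def)
      qed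
      then show ?case by (intro tendsto_eventually eventually_sequentiallyI)
    qed
    show "d i \<in> borel_measurable M" for i unfolding d_def by measurable
  qed (use d_bound in auto)
  then show ?thesis by (rule LIMSEQ_le_const) (use d_nonneg in auto)
qed

text \<open>The sums along \<open>x\<close> and along \<open>T x\<close> differ by the single term
  \<open>g x\<close>, so unboundedness is an exactly invariant condition and has measure 0 or 1;
  measure 1 would force a nonnegative integral.\<close>

lemma AE_bdd_above_birkhoff_sums:
  fixes g :: "'a \<Rightarrow> real"
  assumes "prob_space M" and mp: "measure_preserving M T" and "ergodic M T"
    and [measurable]: "g \<in> borel_measurable M" and C: "\<And>x. \<bar>g x\<bar> \<le> C"
    and neg: "integral\<^sup>L M g < 0"
  shows "AE x in M. bdd_above (range (\<lambda>n. \<Sum>i<n. g ((T ^^ i) x)))"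
proof -
  interpret prob_space M by fact
  have T [measurable]: "T \<in> M \<rightarrow>\<^sub>M M" using mp by (auto simp: measure_preserving_def)
  let ?S = "\<lambda>x n. \<Sum>i<n. g ((T ^^ i) x)"
  define B where "B = {x \<in> space M. \<not> bdd_above (range (?S x))}"
  have B_eq: "B = {x \<in> space M. \<forall>k::nat. \<exists>n. ?S x n > real k}"
    unfolding B_def bdd_above_def
    by (auto simp: not_le) (meson reals_Archimedean2 less_le_trans less_imp_le order.strict_trans)+
  have B [measurable]: "B \<in> sets M" unfolding B_eq by measurable
  have bdd_T: "bdd_above (range (?S x)) \<longleftrightarrow> bdd_above (range (?S (T x)))" for x
  proof
    assume "bdd_above (range (?S x))"
    then obtain K where K: "?S x n \<le> K" for n by (auto simp: bdd_above_def)
    have "?S (T x) n \<le> K - g x" for n using K[of "Suc n"] unfolding birkhoff_sum_Suc by simp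
    then show "bdd_above (range (?S (T x)))" by (auto simp: bdd_above_def)
  next
    assume "bdd_above (range (?S (T x)))"
    then obtain K where K: "?S (T x) n \<le> K" for n by (auto simp: bdd_above_def)
    have "?S x n \<le> max 0 (g x + K)" for n
    proof (cases n)
      case (Suc m)
      then show ?thesis using K[of m] unfolding Suc birkhoff_sum_Suc by simp
    qed simp
    then show "bdd_above (range (?S x))" unfolding bdd_above_def by blast
  qed
  have "T -` B \<inter> space M = B"
    using measurable_space[OF T] bdd_T unfolding B_def by auto
  then consider "measure M B = 0" | "measure M B = 1"
    using \<open>ergodic M T\<close> B unfolding ergodic_def by blast
  then show ?thesis
  proof cases
    case 1
    then have "AE x in M. x \<notin> B" using B by (simp add: AE_iff_measurable prob_eq_0)
    then show ?thesis using AE_space by eventually_elim (auto simp: B_def)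
  next
    case 2
    then have "AE x in M. x \<in> B" using B by (simp add: prob_eq_1)
    then have "AE x in M. \<not> bdd_above (range (?S x))"
      by eventually_elim (auto simp: B_def)
    then have "0 \<le> integral\<^sup>L M g"
      by (intro integral_nonneg_of_unbounded_birkhoff_sums[OF assms(1) mp _ C]) auto
    then show ?thesis using neg by simp
  qed
qed

lemma AE_eventually_birkhoff_average_less:
  fixes f :: "'a \<Rightarrow> real"
  assumes "prob_space M" and mp: "measure_preserving M T" and "ergodic M T"
    and [measurable]: "f \<in> borel_measurable M" and C: "\<And>x. \<bar>f x\<bar> \<le> C" and e: "e > 0"
  shows "AE x in M. eventually (\<lambda>n. (\<Sum>i<n. f ((T ^^ i) x)) / real n < integral\<^sup>L M f + e) sequentially"
proof -
  interpret prob_space M by fact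
  define I where "I = integral\<^sup>L M f"
  \<comment> \<open>Half of the tolerance makes the integral negative; the other half absorbs the
    bound \<open>K\<close> of the sums once \<open>n\<close> is large.\<close>
  define g where "g = (\<lambda>x. f x - (I + e / 2))"
  have "integrable M f" using C by (intro integrable_const_bound[where B = C]) auto
  then have "integral\<^sup>L M g = - e / 2" unfolding g_def by (simp add: I_def prob_space)
  then have neg: "integral\<^sup>L M g < 0" using e by simp
  have "AE x in M. bdd_above (range (\<lambda>n. \<Sum>i<n. g ((T ^^ i) x)))"
  proof (rule AE_bdd_above_birkhoff_sums[OF assms(1-3) _ _ neg])
    show "\<bar>g x\<bar> \<le> C + \<bar>I\<bar> + e" for x using C[of x] e unfolding g_def by linarith
  qed (simp add: g_def)
  then show ?thesis
  proof eventually_elim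
    case (elim x)
    then obtain K where K: "(\<Sum>i<n. g ((T ^^ i) x)) \<le> K" for n by (auto simp: bdd_above_def)
    obtain n0 :: nat where n0: "real n0 > \<bar>K\<bar> / (e / 2)" using reals_Archimedean2 by blast
    show ?case
    proof (rule eventually_sequentiallyI[of "Suc n0"])
      fix n assume n: "Suc n0 \<le> n"
      then have "real n0 < real n" by simp
      then have "\<bar>K\<bar> / (e / 2) < real n" using n0 by linarith
      then have "K < real n * (e / 2)" using e by (simp add: field_simps)
      moreover have "(\<Sum>i<n. f ((T ^^ i) x)) = (\<Sum>i<n. g ((T ^^ i) x)) + real n * (I + e / 2)"
        unfolding g_def by (simp add: sum_subtractf)
      ultimately have "(\<Sum>i<n. f ((T ^^ i) x)) < real n * (e / 2) + real n * (I + e / 2)"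
        using K[of n] by linarith
      also have "\<dots> = (I + e) * real n" by (simp add: algebra_simps)
      finally show "(\<Sum>i<n. f ((T ^^ i) x)) / real n < integral\<^sup>L M f + e"
        using n unfolding I_def by (simp add: divide_less_eq)
    qed
  qed
qed

text \<open>The one-sided estimate for \<open>f\<close> and for \<open>- f\<close>, with the
  countably many tolerances \<open>1 / (k + 1)\<close>, so that one null set serves all of
  them.\<close>

theorem birkhoff_ergodic:
  fixes f :: "'a \<Rightarrow> real"
  assumes "prob_space M" "measure_preserving M T" "ergodic M T"
    and [measurable]: "f \<in> borel_measurable M" and C: "\<And>x. \<bar>f x\<bar> \<le> C"
  shows "AE x in M. (\<lambda>n. (\<Sum>i<n. f ((T ^^ i) x)) / real n) \<longlonglongrightarrow> integral\<^sup>L M f"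
proof -
  have "AE x in M. \<forall>k. eventually (\<lambda>n. (\<Sum>i<n. f ((T ^^ i) x)) / real n
      < integral\<^sup>L M f + 1 / real (Suc k)) sequentially"
    unfolding AE_all_countable
    by (intro allI AE_eventually_birkhoff_average_less[OF assms]) auto
  moreover have "AE x in M. \<forall>k. eventually (\<lambda>n. (\<Sum>i<n. - f ((T ^^ i) x)) / real n
      < integral\<^sup>L M (\<lambda>x. - f x) + 1 / real (Suc k)) sequentially"
    unfolding AE_all_countable
    using C by (intro allI AE_eventually_birkhoff_average_less[OF assms(1-3), where C = C]) auto
  ultimately show ?thesis
  proof eventually_elim
    case (elim x)
    show ?case
    proof (rule LIMSEQ_I)
      fix r :: real assume "r > 0"
      then obtain k where k: "1 / real (Suc k) < r" using nat_approx_posE by blast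
      have "eventually (\<lambda>n. norm ((\<Sum>i<n. f ((T ^^ i) x)) / real n - integral\<^sup>L M f) < r) sequentially"
        using elim(1)[rule_format, of k] elim(2)[rule_format, of k]
        by eventually_elim (use k in \<open>auto simp: sum_negf abs_less_iff\<close>)
      then show "\<exists>no. \<forall>n\<ge>no. norm ((\<Sum>i<n. f ((T ^^ i) x)) / real n - integral\<^sup>L M f) < r"
        by (simp add: eventually_sequentially)
    qed
  qed
qed

subsection \<open>Itineraries\<close>

locale coded_interval_map =
  fixes T :: "real \<Rightarrow> real" and S :: "real set"
  assumes finite_S: "finite S"
    and endpoints: "0 \<in> S" "1 \<in> S"
    and T_unit: "x \<in> {0..1} \<Longrightarrow> T x \<in> {0..1}"
    and T_gap: "\<lbrakk>0 \<le> y; y \<le> z; z \<le> 1; {y..z} \<inter> S = {}\<rbrakk> \<Longrightarrow> continuous_on {y..z} T \<and> inj_on T {y..z}"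
begin

text \<open>The components differ exactly when \<open>y\<close> lies in \<open>S\<close>. Each point
  of \<open>S\<close> is thus alone in its class and the other classes are the gaps of
  \<open>S\<close>, so that no jump of \<open>T\<close> at a cut point occurs within a
  class.\<close>

definition code :: "real \<Rightarrow> real set \<times> real set" where
  "code y = (S \<inter> {..<y}, S \<inter> {..y})"

definition itin :: "nat \<Rightarrow> real \<Rightarrow> (real set \<times> real set) list" where
  "itin n x = map (\<lambda>i. code ((T ^^ i) x)) [0..<n]"

lemma funpow_unit: "x \<in> {0..1} \<Longrightarrow> (T ^^ n) x \<in> {0..1}"
  by (induction n) (use T_unit in auto)

lemma code_eq_iff_less: "y < z \<Longrightarrow> code y = code z \<longleftrightarrow> {y..z} \<inter> S = {}"
proof
  assume "y < z" "code y = code z"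
  then have 1: "s < y \<longleftrightarrow> s < z" "s \<le> y \<longleftrightarrow> s \<le> z" if "s \<in> S" for s
    using that unfolding code_def by blast+
  show "{y..z} \<inter> S = {}"
  proof (intro equals0I)
    fix s assume "s \<in> {y..z} \<inter> S"
    then show False using 1[of s] \<open>y < z\<close> by auto
  qed
next
  assume "y < z" "{y..z} \<inter> S = {}"
  then have "s < y \<longleftrightarrow> s < z" "s \<le> y \<longleftrightarrow> s \<le> z" if "s \<in> S" for s
    using that by (auto simp: disjoint_iff not_le not_less) (meson leI less_imp_le)+
  then show "code y = code z" unfolding code_def by auto
qed

lemma code_eq_iff: "code y = code z \<longleftrightarrow> y = z \<or> closed_segment y z \<inter> S = {}"
proof (cases y z rule: linorder_cases)
  case less
  then show ?thesis using code_eq_iff_less[OF less] by (simp add: closed_segment_eq_real_ivl)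
next
  case greater
  then show ?thesis using code_eq_iff_less[OF greater] by (auto simp add: closed_segment_eq_real_ivl)
qed simp

lemma code_eq_closed_segment:
  assumes "code y = code z" "u \<in> closed_segment y z"
  shows "code u = code y"
proof -
  have "closed_segment y u \<subseteq> closed_segment y z"
    using assms(2) by (simp add: subset_closed_segment)
  then show ?thesis using assms code_eq_iff[of y z] code_eq_iff[of y u] by auto
qed

lemma T_segment:
  assumes "y \<in> {0..1}" "z \<in> {0..1}" "code y = code z"
  shows "continuous_on (closed_segment y z) T" "inj_on T (closed_segment y z)"
proof -
  have "continuous_on (closed_segment y z) T \<and> inj_on T (closed_segment y z)"
  proof (cases "y = z")
    case False
    then have "closed_segment y z \<inter> S = {}" using assms code_eq_iff by blast
    then show ?thesis
      using assms T_gap[of y z] T_gap[of z y] by (auto simp: closed_segment_eq_real_ivl split: if_splits)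
  qed simp
  then show "continuous_on (closed_segment y z) T" "inj_on T (closed_segment y z)" by auto
qed

lemma length_itin [simp]: "length (itin n x) = n"
  by (simp add: itin_def)

lemma itin_0 [simp]: "itin 0 x = []"
  by (simp add: itin_def)

lemma itin_eq_iff: "itin n x = itin n y \<longleftrightarrow> (\<forall>i<n. code ((T ^^ i) x) = code ((T ^^ i) y))"
  by (auto simp: itin_def)

lemma itin_add: "itin (k + r) x = itin k x @ itin r ((T ^^ k) x)"
  by (rule nth_equalityI)
     (auto simp: itin_def nth_append funpow_add[symmetric, THEN fun_cong, unfolded o_def])

lemma itin_add_eq_iff:
  "itin (k + r) x = itin (k + r) y \<longleftrightarrow> itin k x = itin k y \<and> itin r ((T ^^ k) x) = itin r ((T ^^ k) y)"
  by (simp add: itin_add)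

lemma itin_eq_mono: "itin n x = itin n y \<Longrightarrow> k \<le> n \<Longrightarrow> itin k x = itin k y"
  by (auto simp: itin_eq_iff)

text \<open>A continuous injective image of a segment is the segment between the images of its ends,
  so the induction can follow the whole segment: each image up to time \<open>n - 1\<close> avoids
  \<open>S\<close> or is a single point. In particular cylinders are intervals.\<close>

lemma itin_segment:
  assumes "y \<in> {0..1}" "z \<in> {0..1}" "itin n y = itin n z"
  shows "continuous_on (closed_segment y z) (T ^^ n)"
    and "(T ^^ n) ` closed_segment y z = closed_segment ((T ^^ n) y) ((T ^^ n) z)"
    and "u \<in> closed_segment y z \<Longrightarrow> itin n u = itin n y"
    and "inj_on (T ^^ n) (closed_segment y z)"
proof -
  have "continuous_on (closed_segment y z) (T ^^ n) \<and> inj_on (T ^^ n) (closed_segment y z) \<and>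
    (\<forall>u\<in>closed_segment y z. itin n u = itin n y)"
    using assms(3)
  proof (induction n)
    case (Suc n)
    let ?a = "(T ^^ n) y" and ?b = "(T ^^ n) z"
    have "itin n y = itin n z" using Suc.prems by (auto simp: itin_eq_iff)
    note IH' = Suc.IH[OF this]
    have IH: "continuous_on (closed_segment y z) (T ^^ n)" "inj_on (T ^^ n) (closed_segment y z)"
      "\<forall>u\<in>closed_segment y z. itin n u = itin n y" using IH' by blast+
    have im: "(T ^^ n) ` closed_segment y z = closed_segment ?a ?b"
      using IH(1,2) by (rule continuous_injective_image_segment_1)
    have ab: "?a \<in> {0..1}" "?b \<in> {0..1}" "code ?a = code ?b"
      using assms(1,2)[THEN funpow_unit] Suc.prems unfolding itin_eq_iff by simp_all
    have "continuous_on (closed_segment y z) (T \<circ> T ^^ n)" "inj_on (T \<circ> T ^^ n) (closed_segment y z)"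
      by (rule continuous_on_compose[OF IH(1)] comp_inj_on[OF IH(2)], use T_segment[OF ab] im in simp)+
    moreover have "itin (Suc n) u = itin (Suc n) y" if u: "u \<in> closed_segment y z" for u
    proof -
      have "code ((T ^^ n) u) = code ?a" using u im code_eq_closed_segment[OF ab(3)] by blast
      then show ?thesis using IH(3)[rule_format, OF u] unfolding itin_eq_iff less_Suc_eq by blast
    qed
    ultimately show ?case unfolding funpow.simps by blast
  qed auto
  then show "continuous_on (closed_segment y z) (T ^^ n)" "inj_on (T ^^ n) (closed_segment y z)"
    and "u \<in> closed_segment y z \<Longrightarrow> itin n u = itin n y"
    and "(T ^^ n) ` closed_segment y z = closed_segment ((T ^^ n) y) ((T ^^ n) z)"
    using continuous_injective_image_segment_1 by blast+
qed

definition splits :: "nat \<Rightarrow> nat \<Rightarrow> real \<Rightarrow> bool" where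
  "splits n t x \<longleftrightarrow> (\<exists>y\<in>{0..<x}. \<exists>z\<in>{x<..1}. itin n y = itin n x \<and> itin n z = itin n x \<and>
     itin t y \<noteq> itin t x \<and> itin t z \<noteq> itin t x)"

subsection \<open>Closing orbit segments\<close>

text \<open>The \<open>m\<close>-cylinder of \<open>(T ^^ n) x\<close> is an interval that meets the
  image of \<open>{y..z}\<close> but contains neither of its ends, hence lies inside it.\<close>

lemma splits_lift:
  assumes yz: "0 \<le> y" "y < x" "x < z" "z \<le> 1"
    and eq: "itin n y = itin n x" "itin n z = itin n x"
    and neq: "itin (n + m) y \<noteq> itin (n + m) x" "itin (n + m) z \<noteq> itin (n + m) x"
    and w: "w \<in> {0..1}" "itin m w = itin m ((T ^^ n) x)"
  obtains u where "u \<in> {y..z}" "itin (n + m) u = itin (n + m) x" "(T ^^ n) u = w"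
proof -
  let ?a = "(T ^^ n) y" and ?b = "(T ^^ n) z" and ?c = "(T ^^ n) x"
  have seg: "closed_segment y z = {y..z}" using yz by (simp add: closed_segment_eq_real_ivl)
  have u: "y \<in> {0..1}" "z \<in> {0..1}" "itin n y = itin n z" using yz eq by auto
  note im = itin_segment(2)[OF u, unfolded seg]
  have abc: "?a \<in> {0..1}" "?b \<in> {0..1}" "?c \<in> {0..1}" using yz by (auto intro!: funpow_unit[simplified])
  have neq': "itin m ?a \<noteq> itin m ?c" "itin m ?b \<noteq> itin m ?c"
    using neq eq by (auto simp: itin_add_eq_iff)
  have c: "?c \<in> closed_segment ?a ?b" using im yz by auto
  have "?a \<notin> closed_segment w ?c" "?b \<notin> closed_segment w ?c"
    using itin_segment(3)[OF w(1) abc(3) w(2)] w(2) neq' by metis+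
  then have "w \<in> closed_segment ?a ?b"
    using c by (auto simp: closed_segment_eq_real_ivl split: if_splits)
  then obtain u where u': "u \<in> {y..z}" "(T ^^ n) u = w" using im by (metis imageE)
  have "itin n u = itin n x" using itin_segment(3)[OF u, unfolded seg, OF u'(1)] eq by simp
  then have "itin (n + m) u = itin (n + m) x" using u'(2) w(2) by (simp add: itin_add_eq_iff)
  then show ?thesis using that u' by blast
qed

text \<open>With \<open>N = n + m\<close> and \<open>K = s + m\<close>, the points \<open>u1\<close>, \<open>u2\<close> below are moved by \<open>T ^^ N\<close> to the
  \<open>T ^^ K\<close>-images of \<open>y\<close>, \<open>z\<close>, which enclose \<open>(T ^^ K) u1\<close> and \<open>(T ^^ K) u2\<close>; hence
  \<open>T ^^ N - T ^^ K\<close> changes sign between them.\<close>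

lemma periodic_point_of_splits:
  assumes x: "x \<in> {0..1}" and st: "s + m \<le> n"
    and sp: "splits n (n + m) x"
    and w: "itin m ((T ^^ s) x) = itin m ((T ^^ n) x)"
  obtains p where "p \<in> {0..1}" "(T ^^ (n - s)) p = p"
    "itin (n - s) p = itin (n - s) ((T ^^ (s + m)) x)"
proof -
  obtain y z where yz: "0 \<le> y" "y < x" "x < z" "z \<le> 1"
    and eq: "itin n y = itin n x" "itin n z = itin n x"
    and neq: "itin (n + m) y \<noteq> itin (n + m) x" "itin (n + m) z \<noteq> itin (n + m) x"
    using sp unfolding splits_def by auto
  have funpow: "(T ^^ i) ((T ^^ j) v) = (T ^^ (i + j)) v" for i j v by (simp add: funpow_add)
  have lift: "\<exists>u\<in>{y..z}. itin (n + m) u = itin (n + m) x \<and> (T ^^ (n + m)) u = (T ^^ (s + m)) v"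
    if v: "v \<in> {0..1}" "itin n v = itin n x" for v
  proof -
    \<comment> \<open>As \<open>s + m \<le> n\<close>, the point \<open>v\<close> shares with
      \<open>x\<close> the \<open>m\<close>-word read at time \<open>s\<close>, which is also the
      one read at time \<open>n\<close>; so \<open>(T ^^ s) v\<close> is a possible target of the
      lift.\<close>
    have "itin (s + m) v = itin (s + m) x" using v(2) st by (rule itin_eq_mono)
    then have "itin m ((T ^^ s) v) = itin m ((T ^^ n) x)" using w by (simp add: itin_add_eq_iff)
    with funpow_unit[OF v(1)] obtain u
      where "u \<in> {y..z}" "itin (n + m) u = itin (n + m) x" "(T ^^ n) u = (T ^^ s) v"
      using splits_lift[OF yz eq neq] by metis
    moreover from this have "(T ^^ (n + m)) u = (T ^^ (s + m)) v"
      by (metis add.commute funpow)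
    ultimately show ?thesis by blast
  qed
  obtain u1 where u1: "u1 \<in> {y..z}" "itin (n + m) u1 = itin (n + m) x" "(T ^^ (n + m)) u1 = (T ^^ (s + m)) y"
    using lift[of y] eq yz by auto
  obtain u2 where u2: "u2 \<in> {y..z}" "itin (n + m) u2 = itin (n + m) x" "(T ^^ (n + m)) u2 = (T ^^ (s + m)) z"
    using lift[of z] eq yz by auto
  define h where "h = (\<lambda>u. (T ^^ (n + m)) u - (T ^^ (s + m)) u)"
  have u12: "u1 \<in> {0..1}" "u2 \<in> {0..1}" "itin (n + m) u1 = itin (n + m) u2" using u1 u2 yz by auto
  have eq': "itin (s + m) u1 = itin (s + m) u2" using u12(3) by (rule itin_eq_mono) (use st in simp)
  have cont: "continuous_on (closed_segment u1 u2) h"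
    unfolding h_def using itin_segment(1)[OF u12] itin_segment(1)[OF u12(1,2) eq']
    by (intro continuous_on_diff)
  have yz': "y \<in> {0..1}" "z \<in> {0..1}" "itin (s + m) y = itin (s + m) z"
    using yz itin_eq_mono[OF trans[OF eq(1) eq(2)[symmetric]] st] by auto
  have "(T ^^ (s + m)) u1 \<in> closed_segment ((T ^^ (s + m)) y) ((T ^^ (s + m)) z)"
    "(T ^^ (s + m)) u2 \<in> closed_segment ((T ^^ (s + m)) y) ((T ^^ (s + m)) z)"
    using itin_segment(2)[OF yz'] u1(1) u2(1) by (auto simp: closed_segment_eq_real_ivl)
  then have "0 \<in> closed_segment (h u1) (h u2)"
    unfolding h_def u1(3) u2(3) by (auto simp: closed_segment_eq_real_ivl split: if_splits)
  moreover have "closed_segment (h u1) (h u2) \<subseteq> h ` closed_segment u1 u2"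
  proof -
    have "connected (h ` closed_segment u1 u2)"
      by (rule connected_continuous_image[OF cont]) simp
    then have "convex (h ` closed_segment u1 u2)" by (simp add: connected_convex_1[symmetric])
    then show ?thesis by (intro closed_segment_subset) auto
  qed
  ultimately obtain q where q: "q \<in> closed_segment u1 u2" "h q = 0" by force
  have q_unit: "q \<in> {0..1}" using q(1) u12 by (auto simp: closed_segment_eq_real_ivl split: if_splits)
  \<comment> \<open>Of the \<open>n + m\<close> letters that \<open>q\<close> shares with
    \<open>x\<close>, dropping the first \<open>s + m\<close> leaves exactly one period.\<close>
  have nm: "n + m = (s + m) + (n - s)" using st by simp
  have "itin (n + m) q = itin (n + m) x" using itin_segment(3)[OF u12 q(1)] u1(2) by simp
  then have "itin (n - s) ((T ^^ (s + m)) q) = itin (n - s) ((T ^^ (s + m)) x)"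
    unfolding nm itin_add_eq_iff by simp
  moreover have "(T ^^ (n - s)) ((T ^^ (s + m)) q) = (T ^^ (s + m)) q"
    using q(2) st unfolding h_def funpow by (simp add: add.commute)
  ultimately show ?thesis using that funpow_unit[OF q_unit] by blast
qed

subsection \<open>Counting the words of points that rarely split\<close>

text \<open>Each set of one-sided limit words is a singleton, or empty if the words do not settle;
  so no existence of limits has to be shown in order to count them.\<close>

definition adherent_words :: "nat \<Rightarrow> (real set \<times> real set) list set" where
  "adherent_words r = (\<Union>c\<in>S. {itin r c} \<union> {w. \<forall>\<^sub>F y in at_right c. itin r y = w} \<union>
     {w. \<forall>\<^sub>F y in at_left c. itin r y = w})"

lemma finite_card_eventually_eq:
  assumes "F \<noteq> bot"
  shows "finite {w. \<forall>\<^sub>F y in F. f y = w}" "card {w. \<forall>\<^sub>F y in F. f y = w} \<le> 1"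
proof -
  have *: "w = v" if "\<forall>\<^sub>F y in F. f y = w" "\<forall>\<^sub>F y in F. f y = v" for v w
  proof -
    have "\<forall>\<^sub>F y in F. w = v" using that by eventually_elim simp
    then show ?thesis using assms by simp
  qed
  have "is_singleton {w. \<forall>\<^sub>F y in F. f y = w} \<or> {w. \<forall>\<^sub>F y in F. f y = w} = {}"
    unfolding is_singleton_def using * by blast
  then show "finite {w. \<forall>\<^sub>F y in F. f y = w}" "card {w. \<forall>\<^sub>F y in F. f y = w} \<le> 1"
    by (auto simp: is_singleton_def)
qed

lemma adherent_words: "finite (adherent_words r)" "card (adherent_words r) \<le> 3 * card S"
proof -
  let ?A = "\<lambda>c. {itin r c} \<union> {w. \<forall>\<^sub>F y in at_right c. itin r y = w} \<union> {w. \<forall>\<^sub>F y in at_left c. itin r y = w}"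
  note r = finite_card_eventually_eq[OF trivial_limit_at_right_real, of "itin r"]
  note l = finite_card_eventually_eq[OF trivial_limit_at_left_real, of "itin r"]
  show "finite (adherent_words r)"
    unfolding adherent_words_def using finite_S r(1) l(1) by auto
  have "card (?A c) \<le> 3" for c
  proof -
    have "card (?A c) \<le> card {itin r c} + card {w. \<forall>\<^sub>F y in at_right c. itin r y = w} +
        card {w. \<forall>\<^sub>F y in at_left c. itin r y = w}"
      by (meson card_Un_le add_right_mono order_trans)
    also have "\<dots> \<le> 1 + 1 + 1" using r(2)[of c] l(2)[of c] by (intro add_mono) auto
    finally show ?thesis by simp
  qed
  then have "(\<Sum>c\<in>S. card (?A c)) \<le> (\<Sum>c\<in>S. 3)" by (intro sum_mono)
  with card_UN_le[OF finite_S, of ?A] show "card (adherent_words r) \<le> 3 * card S"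
    unfolding adherent_words_def by simp
qed

text \<open>An orbit that avoids \<open>S\<close> before time \<open>n\<close> runs through interior
  points of gaps, where \<open>T\<close> is continuous, so nearby orbits share its codes. Continuity
  of \<open>T ^^ n\<close> is carried along because it brings nearby points into the next
  gap.\<close>

lemma eventually_itin_eq:
  assumes a: "a \<in> {0..1}" and S: "\<And>k. k < n \<Longrightarrow> (T ^^ k) a \<notin> S"
  shows "\<forall>\<^sub>F y in at a. itin n y = itin n a"
proof -
  have "isCont (T ^^ n) a \<and> (\<forall>\<^sub>F y in at a. itin n y = itin n a)"
    using S
  proof (induction n)
    case 0
    have "isCont (\<lambda>x. x) a" by simp
    then show ?case by (simp add: id_def)
  next
    case (Suc n)
    let ?b = "(T ^^ n) a"
    have IH: "isCont (T ^^ n) a" "\<forall>\<^sub>F y in at a. itin n y = itin n a" using Suc by auto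
    have b: "?b \<notin> S" using Suc.prems by blast
    have "?b \<in> {0..1}" using a by (rule funpow_unit)
    then have b01: "?b \<in> {0<..<1}" using b endpoints by (cases "?b = 0"; cases "?b = 1") auto
    have "open ({0<..<1} - S)" using finite_S by (intro open_Diff finite_imp_closed) auto
    then obtain e where e: "e > 0" "cball ?b e \<subseteq> {0<..<1} - S"
      using b b01 open_contains_cball by (metis Diff_iff)
    have cb: "cball ?b e = {?b - e..?b + e}" by (simp add: cball_eq_atLeastAtMost)
    have "?b - e \<in> cball ?b e" "?b + e \<in> cball ?b e" using e(1) by (auto simp: cb)
    then have "?b - e \<in> {0<..<1}" "?b + e \<in> {0<..<1}" using e(2) by blast+
    then have "0 \<le> ?b - e" "?b + e \<le> 1" "{?b - e..?b + e} \<inter> S = {}" using e by (auto simp: cb)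
    then have "continuous_on {?b - e..?b + e} T" using T_gap[of "?b - e" "?b + e"] e(1) by auto
    then have "isCont T ?b"
      using e(1) by (intro continuous_on_interior[of "{?b - e..?b + e}"]) (auto simp: interior_atLeastAtMost_real)
    then have cont: "isCont (T ^^ Suc n) a" unfolding funpow.simps o_def by (rule isCont_o2[OF IH(1)])
    have "\<forall>\<^sub>F y in at a. dist ((T ^^ n) y) ?b < e"
      using IH(1) e(1) unfolding isCont_def tendsto_iff by blast
    then have "\<forall>\<^sub>F y in at a. code ((T ^^ n) y) = code ?b"
    proof eventually_elim
      case (elim y)
      then have "closed_segment ((T ^^ n) y) ?b \<subseteq> cball ?b e"
        by (intro closed_segment_subset) (use e(1) in \<open>auto simp: dist_commute\<close>)
      then show ?case using e unfolding code_eq_iff by blast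
    qed
    with IH(2) have "\<forall>\<^sub>F y in at a. itin (Suc n) y = itin (Suc n) a"
      by eventually_elim (auto simp: itin_eq_iff less_Suc_eq)
    with cont show ?case by blast
  qed
  then show ?thesis by blast
qed

lemma adherent_word_of_segment:
  assumes c: "c \<in> S" and eq: "\<And>v. v \<in> closed_segment c d \<Longrightarrow> v \<noteq> c \<Longrightarrow> itin r v = itin r d"
  shows "itin r d \<in> adherent_words r"
proof (cases c d rule: linorder_cases)
  case less
  then have "\<forall>\<^sub>F v in at_right c. itin r v = itin r d"
    unfolding eventually_at_right[OF less]
    by (intro exI[of _ d]) (auto intro!: eq simp: closed_segment_eq_real_ivl)
  then show ?thesis using c unfolding adherent_words_def by blast
next
  case greater
  then have "\<forall>\<^sub>F v in at_left c. itin r v = itin r d"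
    unfolding eventually_at_left[OF greater]
    by (intro exI[of _ d]) (auto intro!: eq simp: closed_segment_eq_real_ivl)
  then show ?thesis using c unfolding adherent_words_def by blast
qed (use c in \<open>auto simp: adherent_words_def\<close>)

text \<open>Here \<open>a\<close> is an end point of the cylinder of \<open>x\<close>: either a cut point, or its orbit must run
  into one.\<close>

lemma adherent_word_of_end_point:
  assumes a: "a \<in> {0..1}" and x: "x \<in> {0..1}" and nt: "n \<le> t"
    and eq: "\<And>y. y \<in> closed_segment a x \<Longrightarrow> y \<noteq> a \<Longrightarrow> itin t y = itin t x"
    and "end": "a \<in> S \<or> (\<exists>\<^sub>F y in at a. itin n y \<noteq> itin n x)"
  shows "\<exists>k\<le>n. itin (t - k) ((T ^^ k) x) \<in> adherent_words (t - k)"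
proof (rule ccontr)
  assume "\<not> ?thesis"
  then have no: "itin (t - k) ((T ^^ k) x) \<notin> adherent_words (t - k)" if "k \<le> n" for k
    using that by blast
  \<comment> \<open>Such a \<open>v\<close> is the image of a point of the segment other than
    \<open>a\<close>, so it has the remaining word of \<open>x\<close>.\<close>
  have seg: "itin (t - k) v = itin (t - k) ((T ^^ k) x)"
    if k: "k \<le> n" "itin k a = itin k x"
      and v: "v \<in> closed_segment ((T ^^ k) a) ((T ^^ k) x)" "v \<noteq> (T ^^ k) a" for k v
  proof -
    obtain u where u: "u \<in> closed_segment a x" "v = (T ^^ k) u"
      using itin_segment(2)[OF a x k(2)] v(1) by blast
    then have "itin (k + (t - k)) u = itin (k + (t - k)) x" using eq k v nt by auto
    then show ?thesis unfolding itin_add_eq_iff u(2) by simp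
  qed
  have notS: "(T ^^ k) a \<notin> S" if "k \<le> n" "itin k a = itin k x" for k
    using no[OF that(1)] adherent_word_of_segment seg[OF that] by blast
  \<comment> \<open>The point \<open>a\<close> might lie outside the cylinder. Its next code agrees
    nevertheless: another point of \<open>S\<close> on the segment would have the code of
    \<open>?d\<close>, hence equal \<open>?d\<close>, and then the remaining word would be adherent
    at \<open>?d\<close> itself.\<close>
  have itin_a: "itin k a = itin k x" if "k \<le> n" for k
    using that
  proof (induction k)
    case (Suc k)
    let ?c = "(T ^^ k) a" and ?d = "(T ^^ k) x"
    have k: "k \<le> n" "itin k a = itin k x" using Suc by auto
    have dS: "?d \<notin> S" using no[OF k(1)] by (auto simp: adherent_words_def)
    have code: "code v = code ?d" if "v \<in> closed_segment ?c ?d" "v \<noteq> ?c" for v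
      using seg[OF k that] Suc.prems nt unfolding itin_eq_iff by (auto dest!: spec[of _ 0])
    have "closed_segment ?c ?d \<inter> S = {}"
    proof (rule ccontr)
      assume "closed_segment ?c ?d \<inter> S \<noteq> {}"
      then obtain s where s: "s \<in> closed_segment ?c ?d" "s \<in> S" by blast
      moreover have "s \<noteq> ?c" using notS[OF k] s by blast
      ultimately have "code s = code ?d" using code by blast
      then show False using s(2) dS unfolding code_eq_iff by auto
    qed
    then have "code ?c = code ?d" by (simp add: code_eq_iff)
    then show ?case using k(2) by (auto simp: itin_eq_iff less_Suc_eq)
  qed simp
  have "\<forall>\<^sub>F y in at a. itin n y = itin n a"
    using a by (rule eventually_itin_eq) (use notS itin_a in auto)
  then have "\<not> (\<exists>\<^sub>F y in at a. itin n y \<noteq> itin n x)"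
    using itin_a[of n] by (simp add: frequently_def)
  moreover have "a \<notin> S" using notS[of 0] by simp
  ultimately show False using "end" by blast
qed

text \<open>Without a split, the \<open>n\<close>-word determines the \<open>t\<close>-word on one
  side of \<open>x\<close>, all the way to the end of the cylinder. That end, an infimum or a
  supremum, is the point whose orbit is followed.\<close>

lemma adherent_word_of_not_splits:
  assumes x: "x \<in> {0..1}" and nt: "n \<le> t" and not: "\<not> splits n t x"
  shows "\<exists>k\<le>n. itin (t - k) ((T ^^ k) x) \<in> adherent_words (t - k)"
proof -
  consider "\<forall>y\<in>{0..<x}. itin n y = itin n x \<longrightarrow> itin t y = itin t x"
    | "\<forall>y\<in>{x<..1}. itin n y = itin n x \<longrightarrow> itin t y = itin t x"
    using not unfolding splits_def by blast
  then show ?thesis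
  proof cases
    case 1
    define L where "L = {y \<in> {0..x}. itin n y = itin n x}"
    define a where "a = Inf L"
    have L: "x \<in> L" "bdd_below L" "L \<noteq> {}" using x by (auto simp: L_def bdd_below_def)
    have a: "0 \<le> a" "a \<le> x" unfolding a_def using L
      by (auto intro!: cInf_greatest cInf_lower simp: L_def)
    show ?thesis
    proof (rule adherent_word_of_end_point[of a])
      fix y assume "y \<in> closed_segment a x" "y \<noteq> a"
      then have y: "a < y" "y \<le> x" using a by (auto simp: closed_segment_eq_real_ivl)
      then obtain l where l: "l \<in> L" "l < y" unfolding a_def using cInf_less_iff[OF L(3,2)] by blast
      then have "y \<in> closed_segment l x" using y by (auto simp: closed_segment_eq_real_ivl)
      then have "itin n y = itin n x" using itin_segment(3)[of l x n y] l x by (auto simp: L_def)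
      then show "itin t y = itin t x" using 1 y a by (cases "y = x") auto
    next
      \<comment> \<open>Either \<open>a\<close> is 0, a point of \<open>S\<close>, or agreement of
        the words near \<open>a\<close> would let \<open>L\<close> continue below its
        infimum.\<close>
      show "a \<in> S \<or> (\<exists>\<^sub>F y in at a. itin n y \<noteq> itin n x)"
      proof (cases "a = 0")
        case False
        then have "0 < a" using a by simp
        have "\<not> (\<forall>\<^sub>F y in at a. itin n y = itin n x)"
        proof
          assume "\<forall>\<^sub>F y in at a. itin n y = itin n x"
          then have "\<forall>\<^sub>F y in at_left a. itin n y = itin n x" by (simp add: eventually_at_split)
          then obtain b where b: "b < a" "\<forall>y>b. y < a \<longrightarrow> itin n y = itin n x"
            unfolding eventually_at_left[OF \<open>0 < a\<close>] by blast
          obtain y where y: "max b 0 < y" "y < a" using dense[of "max b 0" a] b(1) \<open>0 < a\<close> by auto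
          then have "y \<in> L" using b(2) a by (auto simp: L_def)
          then show False using cInf_lower[OF _ L(2), of y] y(2) unfolding a_def by simp
        qed
        then show ?thesis by (simp add: frequently_def)
      qed (use endpoints in simp)
    qed (use a x nt in auto)
  next
    case 2
    define L where "L = {y \<in> {x..1}. itin n y = itin n x}"
    define a where "a = Sup L"
    have L: "x \<in> L" "bdd_above L" "L \<noteq> {}" using x by (auto simp: L_def bdd_above_def)
    have a: "x \<le> a" "a \<le> 1" unfolding a_def using L
      by (auto intro!: cSup_least cSup_upper simp: L_def)
    show ?thesis
    proof (rule adherent_word_of_end_point[of a])
      fix y assume "y \<in> closed_segment a x" "y \<noteq> a"
      then have y: "y < a" "x \<le> y" using a by (auto simp: closed_segment_eq_real_ivl split: if_splits)
      then obtain l where l: "l \<in> L" "y < l" unfolding a_def using less_cSup_iff[OF L(3,2)] by blast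
      then have "y \<in> closed_segment l x" using y by (auto simp: closed_segment_eq_real_ivl)
      then have "itin n y = itin n x" using itin_segment(3)[of l x n y] l x by (auto simp: L_def)
      then show "itin t y = itin t x" using 2 y a by (cases "y = x") auto
    next
      show "a \<in> S \<or> (\<exists>\<^sub>F y in at a. itin n y \<noteq> itin n x)"
      proof (cases "a = 1")
        case False
        then have "a < 1" using a by simp
        have "\<not> (\<forall>\<^sub>F y in at a. itin n y = itin n x)"
        proof
          assume "\<forall>\<^sub>F y in at a. itin n y = itin n x"
          then have "\<forall>\<^sub>F y in at_right a. itin n y = itin n x" by (simp add: eventually_at_split)
          then obtain b where b: "b > a" "\<forall>y>a. y < b \<longrightarrow> itin n y = itin n x"
            unfolding eventually_at_right[OF \<open>a < 1\<close>] by blast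
          obtain y where y: "a < y" "y < min b 1" using dense[of a "min b 1"] b(1) \<open>a < 1\<close> by auto
          then have "y \<in> L" using b(2) a by (auto simp: L_def)
          then show False using cSup_upper[OF _ L(2), of y] y(1) unfolding a_def by simp
        qed
        then show ?thesis by (simp add: frequently_def)
      qed (use endpoints in simp)
    qed (use a x nt in auto)
  qed
qed

definition codes :: "(real set \<times> real set) set" where
  "codes = Pow S \<times> Pow S"

lemma finite_codes: "finite codes"
  using finite_S by (simp add: codes_def)

lemma code_in_codes: "code x \<in> codes"
  by (auto simp: code_def codes_def)

lemma itin_in_words: "itin n x \<in> {w. set w \<subseteq> codes \<and> length w = n}"
  using code_in_codes by (auto simp: itin_def)

lemma finite_words: "finite (itin n ` G)"
  by (rule finite_subset[OF _ finite_lists_length_eq[OF finite_codes, of n]]) (use itin_in_words in auto)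

text \<open>Cutting the word of \<open>x\<close> at the time \<open>k\<close> leaves a
  \<open>k\<close>-word of the same \<open>x\<close> and an adherent word. Both sides thus count
  words of the same \<open>G\<close>, which makes the estimate a recursion, delayed by
  \<open>m\<close> because \<open>k \<le> t - m\<close>.\<close>

lemma card_words_not_splits:
  assumes G: "G \<subseteq> {0..1}" and mt: "m \<le> t" and not: "\<And>x. x \<in> G \<Longrightarrow> \<not> splits (t - m) t x"
  shows "card (itin t ` G) \<le> 3 * card S * (\<Sum>k\<le>t - m. card (itin k ` G))"
proof -
  let ?U = "\<lambda>k. (\<lambda>(u, v). u @ v) ` ((itin k ` G) \<times> adherent_words (t - k))"
  have "itin t ` G \<subseteq> (\<Union>k\<le>t - m. ?U k)"
  proof
    fix w assume "w \<in> itin t ` G"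
    then obtain x where x: "x \<in> G" "w = itin t x" by blast
    obtain k where k: "k \<le> t - m" "itin (t - k) ((T ^^ k) x) \<in> adherent_words (t - k)"
      using adherent_word_of_not_splits[OF _ _ not[OF x(1)]] x(1) G by (meson diff_le_self subsetD)
    have "w = itin k x @ itin (t - k) ((T ^^ k) x)"
      using k mt x(2) itin_add[of k "t - k" x] by simp
    then show "w \<in> (\<Union>k\<le>t - m. ?U k)" using x(1) k by (intro UN_I[of k]) force+
  qed
  then have "card (itin t ` G) \<le> card (\<Union>k\<le>t - m. ?U k)"
    using finite_words adherent_words(1) by (intro card_mono) auto
  also have "\<dots> \<le> (\<Sum>k\<le>t - m. card (?U k))" by (rule card_UN_le) simp
  also have "\<dots> \<le> (\<Sum>k\<le>t - m. card (itin k ` G) * (3 * card S))"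
  proof (rule sum_mono)
    fix k
    have "card (?U k) \<le> card (itin k ` G \<times> adherent_words (t - k))"
      using finite_words adherent_words(1) by (intro card_image_le finite_cartesian_product) auto
    also have "\<dots> \<le> card (itin k ` G) * (3 * card S)"
      using adherent_words(2) by (simp add: card_cartesian_product)
    finally show "card (?U k) \<le> card (itin k ` G) * (3 * card S)" .
  qed
  also have "\<dots> = 3 * card S * (\<Sum>k\<le>t - m. card (itin k ` G))"
    by (simp add: sum_distrib_left mult.commute mult.left_commute)
  finally show ?thesis .
qed

end

text \<open>Induction with the guess \<open>C * \<theta> ^ t\<close>: the geometric sum costs a
  factor \<open>\<theta> / (\<theta> - 1)\<close>, which together with \<open>D\<close> is
  outweighed by the \<open>m\<close> missing powers of \<theta>. The constant \<open>C\<close> takes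
  care of the times up to \<open>t0 + m\<close>.\<close>

lemma delayed_recursion_growth:
  fixes a :: "nat \<Rightarrow> real" and \<theta> D :: real
  assumes \<theta>: "\<theta> > 1" and D: "0 \<le> D" "D * \<theta> \<le> (\<theta> - 1) * \<theta> ^ m"
    and rec: "\<And>t. t \<ge> t0 \<Longrightarrow> m \<le> t \<Longrightarrow> a t \<le> D * (\<Sum>k\<le>t - m. a k)" and "0 < m"
  shows "\<exists>C>0. \<forall>t. a t \<le> C * \<theta> ^ t"
proof -
  define C where "C = 1 + (\<Sum>k\<le>t0 + m. \<bar>a k\<bar>)"
  have "C > 0" unfolding C_def by (intro add_pos_nonneg sum_nonneg) auto
  have "a t \<le> C * \<theta> ^ t" for t
  proof (induction t rule: less_induct)
    case (less t)
    show ?case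
    proof (cases "t \<le> t0 + m")
      case True
      then have "\<bar>a t\<bar> \<le> (\<Sum>k\<le>t0 + m. \<bar>a k\<bar>)" by (intro member_le_sum) auto
      then have "a t \<le> C * 1" unfolding C_def by simp
      also have "\<dots> \<le> C * \<theta> ^ t" using \<theta> \<open>C > 0\<close> by (intro mult_left_mono one_le_power) auto
      finally show ?thesis .
    next
      case False
      have "a t \<le> D * (\<Sum>k\<le>t - m. a k)" using False by (intro rec) auto
      also have "\<dots> \<le> D * (\<Sum>k\<le>t - m. C * \<theta> ^ k)"
        using False \<open>0 < m\<close> D(1) by (intro mult_left_mono sum_mono less) auto
      also have "\<dots> = C * (D * (\<Sum>k\<le>t - m. \<theta> ^ k))" by (simp add: sum_distrib_left algebra_simps)
      also have "\<dots> \<le> C * \<theta> ^ t"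
      proof (intro mult_left_mono)
        have "(\<theta> - 1) * (\<Sum>k\<le>t - m. \<theta> ^ k) = \<theta> ^ Suc (t - m) - 1"
          by (simp add: power_diff_1_eq[of \<theta> "Suc (t - m)"] lessThan_Suc_atMost del: power_Suc sum.lessThan_Suc)
        then have "(\<theta> - 1) * (\<Sum>k\<le>t - m. \<theta> ^ k) \<le> \<theta> * \<theta> ^ (t - m)" by simp
        then have "D * ((\<theta> - 1) * (\<Sum>k\<le>t - m. \<theta> ^ k)) \<le> D * \<theta> * \<theta> ^ (t - m)"
          using mult_left_mono[OF _ D(1)] by (simp add: mult.assoc)
        also have "\<dots> \<le> (\<theta> - 1) * \<theta> ^ m * \<theta> ^ (t - m)"
          using \<theta> D(2) by (intro mult_right_mono) auto
        also have "\<dots> = (\<theta> - 1) * \<theta> ^ t" using False by (simp add: power_add[symmetric])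
        finally have "(\<theta> - 1) * (D * (\<Sum>k\<le>t - m. \<theta> ^ k)) \<le> (\<theta> - 1) * \<theta> ^ t"
          by (simp add: mult.left_commute)
        then show "D * (\<Sum>k\<le>t - m. \<theta> ^ k) \<le> \<theta> ^ t" using \<theta> by simp
      qed (use \<open>C > 0\<close> in simp)
      finally show ?thesis .
    qed
  qed
  with \<open>C > 0\<close> show ?thesis by blast
qed

subsection \<open>An entropy bound from counting words\<close>

definition cell_of :: "'a set set \<Rightarrow> 'a \<Rightarrow> 'a set" where
  "cell_of P x = (THE p. p \<in> P \<and> x \<in> p)"

lemma cell_of_eq:
  assumes "partition_on A P" "p \<in> P" "x \<in> p"
  shows "cell_of P x = p"
  unfolding cell_of_def
  using assms by (intro the_equality) (auto dest: partition_onD2 disjointD)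

lemma cell_of:
  assumes "partition_on A P" "x \<in> A"
  shows "cell_of P x \<in> P" "x \<in> cell_of P x"
proof -
  obtain p where "p \<in> P" "x \<in> p" using partition_onD1[OF assms(1)] assms(2) by blast
  then show "cell_of P x \<in> P" "x \<in> cell_of P x" using cell_of_eq[OF assms(1)] by metis+
qed

lemma cell_of_eq_iff:
  assumes "partition_on A P" "x \<in> A" "p \<in> P"
  shows "cell_of P x = p \<longleftrightarrow> x \<in> p"
  using assms cell_of cell_of_eq by metis

text \<open>Extensional on \<open>{..<n}\<close>, so that itineraries lie in a finite
  \<open>PiE\<close>, over which products of weights can be summed.\<close>

definition itinerary_of :: "('a \<Rightarrow> 'a) \<Rightarrow> 'a set set \<Rightarrow> nat \<Rightarrow> 'a \<Rightarrow> nat \<Rightarrow> 'a set" where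
  "itinerary_of T P n x = (\<lambda>i\<in>{..<n}. cell_of P ((T ^^ i) x))"

lemma itinerary_of_eq_iff:
  "itinerary_of T P n x = itinerary_of T P n y \<longleftrightarrow> (\<forall>i<n. cell_of P ((T ^^ i) x) = cell_of P ((T ^^ i) y))"
  by (auto simp: itinerary_of_def fun_eq_iff restrict_def)

lemma funpow_in_space:
  assumes "T \<in> M \<rightarrow>\<^sub>M M" "x \<in> space M"
  shows "(T ^^ i) x \<in> space M"
  using assms(2) by (induction i) (use measurable_space[OF assms(1)] in auto)

text \<open>Presents the join as the fibres of the itinerary map. Positive \<open>n\<close> avoids
  the empty intersection, which is \<open>UNIV\<close> and not \<open>space M\<close>.\<close>

lemma iterated_join_eq:
  assumes T: "T \<in> M \<rightarrow>\<^sub>M M" and P: "partition_on (space M) P" and n: "0 < n"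
  shows "iterated_join M T P n =
    (\<lambda>x. {y \<in> space M. itinerary_of T P n y = itinerary_of T P n x}) ` space M" (is "_ = ?C ` _")
proof -
  let ?R = "\<lambda>i. preimage_partition M (T ^^ i) P"
  have eq: "\<Inter> (f ` ?R ` {..<n}) = ?C x"
    if f: "\<And>i. i < n \<Longrightarrow> f (?R i) \<in> ?R i" and x: "\<And>i. i < n \<Longrightarrow> x \<in> f (?R i)" for f x
  proof -
    have fR: "f (?R i) = {y \<in> space M. cell_of P ((T ^^ i) y) = cell_of P ((T ^^ i) x)}" if i: "i < n" for i
    proof -
      obtain p where p: "p \<in> P" "f (?R i) = (T ^^ i) -` p \<inter> space M"
        using f[OF i] unfolding preimage_partition_def by blast
      then have "(T ^^ i) x \<in> p" using x[OF i] by auto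
      then have "cell_of P ((T ^^ i) x) = p" using cell_of_eq[OF P p(1)] by blast
      moreover have "cell_of P ((T ^^ i) y) = p \<longleftrightarrow> (T ^^ i) y \<in> p" if "y \<in> space M" for y
        using cell_of_eq_iff[OF P funpow_in_space[OF T that] p(1)] .
      ultimately show ?thesis using p(2) by auto
    qed
    have "\<Inter> (f ` ?R ` {..<n}) = (\<Inter>i<n. f (?R i))" by auto
    also have "\<dots> = (\<Inter>i<n. {y \<in> space M. cell_of P ((T ^^ i) y) = cell_of P ((T ^^ i) x)})"
      using fR by auto
    also have "\<dots> = ?C x" using n unfolding itinerary_of_eq_iff by auto
    finally show ?thesis .
  qed
  show ?thesis
  proof (intro equalityI subsetI)
    fix X assume "X \<in> iterated_join M T P n"
    then obtain f where f: "\<And>i. i < n \<Longrightarrow> f (?R i) \<in> ?R i" "X = \<Inter> (f ` ?R ` {..<n})" "X \<noteq> {}"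
      unfolding iterated_join_def common_refinement by auto
    then obtain x where x: "x \<in> X" by blast
    then have "\<And>i. i < n \<Longrightarrow> x \<in> f (?R i)" using f(2) by auto
    then have "X = ?C x" using eq f by simp
    with x show "X \<in> ?C ` space M" by blast
  next
    fix X assume "X \<in> ?C ` space M"
    then obtain x where x: "x \<in> space M" "X = ?C x" by blast
    \<comment> \<open>The join is over a set of partitions, so the choice depends on the partition
      and not on the time; taking the piece that contains \<open>x\<close> is consistent when
      partitions of different times coincide.\<close>
    define f where "f R = (SOME r. r \<in> R \<and> x \<in> r)" for R :: "'a set set"
    have f: "f (?R i) \<in> ?R i \<and> x \<in> f (?R i)" for i
      unfolding f_def
    proof (rule someI)
      have "(T ^^ i) x \<in> space M" using T x(1) by (rule funpow_in_space)
      note c = cell_of[OF P this]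
      then have "x \<in> (T ^^ i) -` cell_of P ((T ^^ i) x) \<inter> space M" using x(1) by simp
      with c(1) show "(T ^^ i) -` cell_of P ((T ^^ i) x) \<inter> space M \<in> ?R i \<and>
          x \<in> (T ^^ i) -` cell_of P ((T ^^ i) x) \<inter> space M"
        unfolding preimage_partition_def by blast
    qed
    have "X = \<Inter> (f ` ?R ` {..<n})" using eq[of f x] f x(2) by simp
    moreover have "X \<noteq> {}" using x by auto
    ultimately show "X \<in> iterated_join M T P n"
      unfolding iterated_join_def common_refinement using f by blast
  qed
qed

text \<open>Termwise this is \<open>ln t \<le> t - 1\<close> at \<open>t = r a / p a\<close>. Any
  subprobability weights thereby give an upper bound for an entropy.\<close>

lemma gibbs_inequality:
  fixes p r :: "'a \<Rightarrow> real"
  assumes "finite N" and p: "\<And>a. a \<in> N \<Longrightarrow> 0 \<le> p a" "sum p N = 1"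
    and r: "\<And>a. a \<in> N \<Longrightarrow> 0 < r a" "sum r N \<le> 1"
  shows "- (\<Sum>a\<in>N. p a * ln (p a)) \<le> (\<Sum>a\<in>N. p a * - ln (r a))"
proof -
  have "p a * ln (r a) - p a * ln (p a) \<le> r a - p a" if a: "a \<in> N" for a
  proof (cases "p a = 0")
    case False
    then have pos: "0 < p a" "0 < r a" using p(1) r(1) a by (auto simp: less_le)
    have "p a * ln (r a) - p a * ln (p a) = p a * ln (r a / p a)"
      using pos by (simp add: ln_div algebra_simps)
    also have "\<dots> \<le> p a * (r a / p a - 1)"
      using pos by (intro mult_left_mono ln_le_minus_one) auto
    finally show ?thesis using pos by (simp add: algebra_simps)
  qed (use r(1)[OF a] in simp)
  then have "(\<Sum>a\<in>N. p a * ln (r a) - p a * ln (p a)) \<le> (\<Sum>a\<in>N. r a - p a)" by (intro sum_mono)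
  then show ?thesis using p(2) r(2) by (simp add: sum_subtractf sum_negf)
qed

text \<open>Gibbs' inequality is applied to the following weights: guess the code word of length \<open>n\<close>,
  half of the time among the words of points of \<open>A\<close>; then read off a cell of \<open>P\<close> from each letter
  by means of \<open>\<phi>\<close>, replacing it with probability \<open>\<eta>\<close> by a uniformly chosen one.\<close>

lemma partition_entropy_iterated_join_le:
  fixes c :: "'a \<Rightarrow> 'c" and \<phi> :: "'c \<Rightarrow> 'a set" and \<eta> :: real
  assumes "prob_space M" and mp: "measure_preserving M T" and P: "finite_measurable_partition M P"
    and n: "0 < n" and Q: "finite Q" "\<And>x. x \<in> space M \<Longrightarrow> c x \<in> Q"
    and A: "A \<in> sets M" and \<eta>: "0 < \<eta>" "\<eta> < 1"
    and B: "B \<in> sets M" "\<And>x. x \<in> space M - B \<Longrightarrow> cell_of P x = \<phi> (c x)"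
  shows "partition_entropy M (iterated_join M T P n) \<le>
    ln 2 + ln (real (card ((\<lambda>x. map (\<lambda>i. c ((T ^^ i) x)) [0..<n]) ` A))) + measure M (space M - A) * real n * ln (real (card Q)) +
    real n * (- ln (1 - \<eta>) + measure M B * ln (real (card P) / \<eta>))"
proof -
  interpret prob_space M by fact
  have T [measurable]: "T \<in> M \<rightarrow>\<^sub>M M" and distr: "distr M M T = M"
    using mp by (auto simp: measure_preserving_def)
  have P': "finite P" "P \<subseteq> sets M" "partition_on (space M) P"
    using P by (auto simp: finite_measurable_partition_def)
  obtain x0 where x0: "x0 \<in> space M" using not_empty by blast
  have card_P: "1 \<le> real (card P)"
    using cell_of(1)[OF P'(3) x0] P'(1) by (simp add: Suc_le_eq card_gt_0_iff) blast
  have card_Q: "1 \<le> real (card Q)"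
    using Q x0 by (simp add: Suc_le_eq card_gt_0_iff) blast
  note space = funpow_in_space[OF T]
  define w where "w = (\<lambda>x. map (\<lambda>i. c ((T ^^ i) x)) [0..<n])"
  define name where "name = itinerary_of T P n"
  define N where "N = name ` space M"
  define C where "C a = {y \<in> space M. name y = a}" for a
  have name_PiE: "name x \<in> PiE {..<n} (\<lambda>_. P)" if "x \<in> space M" for x
    using cell_of(1)[OF P'(3) space[OF that]] by (auto simp: name_def itinerary_of_def)
  have fin_PiE: "finite (PiE {..<n} (\<lambda>_. P))" by (intro finite_PiE P'(1)) auto
  have N_sub: "N \<subseteq> PiE {..<n} (\<lambda>_. P)" using name_PiE by (auto simp: N_def)
  then have fin_N: "finite N" using fin_PiE by (rule finite_subset)
  have C_sets [measurable]: "C a \<in> sets M" if "a \<in> N" for a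
  proof -
    have aP: "a i \<in> P" if "i < n" for i using N_sub \<open>a \<in> N\<close> that by (auto simp: PiE_iff)
    have "C a = {y \<in> space M. \<forall>i\<in>{..<n}. (T ^^ i) y \<in> a i}"
    proof -
      have "name y = a \<longleftrightarrow> (\<forall>i\<in>{..<n}. (T ^^ i) y \<in> a i)" if y: "y \<in> space M" for y
      proof -
        have "name y = a \<longleftrightarrow> (\<forall>i\<in>{..<n}. name y i = a i)"
          using PiE_ext[OF name_PiE[OF y], of a] N_sub \<open>a \<in> N\<close> by auto
        also have "\<dots> \<longleftrightarrow> (\<forall>i\<in>{..<n}. (T ^^ i) y \<in> a i)"
          using cell_of_eq_iff[OF P'(3) space[OF y] aP] by (simp add: name_def itinerary_of_def)
        finally show ?thesis .
      qed
      then show ?thesis unfolding C_def by auto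
    qed
    also have "\<dots> \<in> sets M"
    proof (rule sets.sets_Collect_finite_All)
      fix i assume "i \<in> {..<n}"
      then have [measurable]: "a i \<in> sets M" using aP P'(2) by blast
      show "{y \<in> space M. (T ^^ i) y \<in> a i} \<in> sets M" by measurable
    qed simp
    finally show ?thesis .
  qed
  have "iterated_join M T P n = C ` N"
    unfolding iterated_join_eq[OF T P'(3) n] N_def C_def name_def by (simp add: image_image)
  moreover have "inj_on C N"
    by (rule inj_onI) (auto simp: C_def N_def)
  ultimately have entropy: "partition_entropy M (iterated_join M T P n) =
      - (\<Sum>a\<in>N. measure M (C a) * ln (measure M (C a)))"
    by (simp add: partition_entropy_def sum.reindex)
  have disj: "disjoint_family_on C N" by (auto simp: disjoint_family_on_def C_def)
  have "(\<Union>a\<in>N. C a) = space M" by (auto simp: C_def N_def)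
  then have sum_C: "(\<Sum>a\<in>N. measure M (C a)) = 1"
    using finite_measure_finite_Union[OF fin_N _ disj] C_sets prob_space by (metis image_subsetI)
  define words where "words = {v. set v \<subseteq> Q \<and> length v = n}"
  have fin_words: "finite words" unfolding words_def using Q(1) by (rule finite_lists_length_eq)
  have card_words: "card words = card Q ^ n" unfolding words_def by (rule card_lists_length_eq[OF Q(1)])
  have w_words: "w x \<in> words" if "x \<in> space M" for x
    using Q(2) space[OF that] by (auto simp: w_def words_def)
  define W where "W = w ` A"
  have W: "W \<subseteq> words" using w_words sets.sets_into_space[OF A] by (auto simp: W_def)
  \<comment> \<open>The uniform part keeps the weight positive for words of points outside
    \<open>A\<close>, at a cost of at most \<open>ln 2 + n * ln (card Q)\<close>.\<close>
  define \<omega> where "\<omega> v = (if v \<in> W then 1 / (2 * real (card W)) else 0) + 1 / (2 * real (card Q) ^ n)" for v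
  define \<rho> where "\<rho> q p = (if p = \<phi> q then 1 - \<eta> else 0) + \<eta> / real (card P)" for q p
  have \<omega>_pos: "0 < \<omega> v" for v using card_Q unfolding \<omega>_def by (intro add_nonneg_pos) auto
  have \<rho>_pos: "0 < \<rho> q p" for q p using \<eta> card_P unfolding \<rho>_def by (intro add_nonneg_pos) auto
  \<comment> \<open>The weight with which the random reading produces the name \<open>a\<close>.
    Summing over all names factorises, while the term of the true word of \<open>x\<close> alone
    gives the lower bound.\<close>
  define r where "r a = (\<Sum>v\<in>words. \<omega> v * (\<Prod>i<n. \<rho> (v ! i) (a i)))" for a
  have sum_\<omega>: "(\<Sum>v\<in>words. \<omega> v) \<le> 1"
  proof -
    have "(\<Sum>v\<in>words. if v \<in> W then 1 / (2 * real (card W)) else 0) = (\<Sum>v\<in>W. 1 / (2 * real (card W)))"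
      using W fin_words by (simp add: sum.If_cases Int_absorb1)
    also have "\<dots> \<le> 1 / 2" by simp
    finally show ?thesis unfolding \<omega>_def sum.distrib using card_words card_Q by simp
  qed
  have sum_\<rho>: "(\<Sum>p\<in>P. \<rho> q p) \<le> 1" for q
  proof -
    have "(\<Sum>p\<in>P. if p = \<phi> q then 1 - \<eta> else 0) \<le> 1 - \<eta>"
      using P'(1) \<eta> by (simp add: sum.delta)
    then show ?thesis unfolding \<rho>_def sum.distrib using card_P by simp
  qed
  have "(\<Sum>a\<in>N. r a) \<le> (\<Sum>a\<in>PiE {..<n} (\<lambda>_. P). r a)"
    unfolding r_def using \<omega>_pos \<rho>_pos
    by (intro sum_mono2[OF fin_PiE N_sub] sum_nonneg mult_nonneg_nonneg prod_nonneg) (auto intro: less_imp_le)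
  also have "\<dots> = (\<Sum>v\<in>words. \<omega> v * (\<Sum>a\<in>PiE {..<n} (\<lambda>_. P). \<Prod>i<n. \<rho> (v ! i) (a i)))"
    unfolding r_def by (subst sum.swap) (simp add: sum_distrib_left)
  also have "\<dots> = (\<Sum>v\<in>words. \<omega> v * (\<Prod>i<n. \<Sum>p\<in>P. \<rho> (v ! i) p))"
    using P'(1) by (subst prod_sum_PiE) auto
  also have "\<dots> \<le> (\<Sum>v\<in>words. \<omega> v * 1)"
    using \<omega>_pos \<rho>_pos sum_\<rho>
    by (intro sum_mono mult_left_mono prod_le_1 conjI sum_nonneg) (auto intro: less_imp_le)
  also have "\<dots> \<le> 1" using sum_\<omega> by simp
  finally have sum_r: "(\<Sum>a\<in>N. r a) \<le> 1" .
  have r_ge: "\<omega> (w x) * (\<Prod>i<n. \<rho> (c ((T ^^ i) x)) (cell_of P ((T ^^ i) x))) \<le> r (name x)"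
    if x: "x \<in> space M" for x
  proof -
    have "\<omega> (w x) * (\<Prod>i<n. \<rho> (c ((T ^^ i) x)) (cell_of P ((T ^^ i) x))) =
        \<omega> (w x) * (\<Prod>i<n. \<rho> (w x ! i) (name x i))"
      by (simp add: w_def name_def itinerary_of_def)
    also have "\<dots> \<le> r (name x)"
      unfolding r_def using \<omega>_pos \<rho>_pos
      by (intro member_le_sum[OF w_words[OF x] _ fin_words] mult_nonneg_nonneg prod_nonneg)
        (auto intro: less_imp_le)
    finally show ?thesis .
  qed
  have lower_pos: "0 < \<omega> (w x) * (\<Prod>i<n. \<rho> (c ((T ^^ i) x)) (cell_of P ((T ^^ i) x)))" for x
    using \<omega>_pos \<rho>_pos by (intro mult_pos_pos prod_pos) auto
  have r_pos: "0 < r a" if "a \<in> N" for a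
    using that lower_pos r_ge unfolding N_def by (auto intro: less_le_trans)
  \<comment> \<open>Written with indicators, so that integrating against the invariant measure turns
    every time \<open>i\<close> into \<open>measure M B\<close>.\<close>
  define bound where "bound x = ln 2 + ln (real (card W)) +
      indicator (space M - A) x * (real n * ln (real (card Q))) +
      (\<Sum>i<n. - ln (1 - \<eta>) + indicator B ((T ^^ i) x) * ln (real (card P) / \<eta>))" for x
  have \<omega>_bound: "- ln (\<omega> (w x)) \<le> ln 2 + ln (real (card W)) +
      indicator (space M - A) x * (real n * ln (real (card Q)))" if x: "x \<in> space M" for x
  proof (cases "x \<in> A")
    case True
    then have "w x \<in> W" by (auto simp: W_def)
    then have cW: "0 < card W" using finite_subset[OF W fin_words] by (auto simp: card_gt_0_iff)
    have "1 / (2 * real (card W)) \<le> \<omega> (w x)" using \<open>w x \<in> W\<close> by (simp add: \<omega>_def)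
    then have "ln (1 / (2 * real (card W))) \<le> ln (\<omega> (w x))" using cW \<omega>_pos by (subst ln_le_cancel_iff) auto
    then show ?thesis using cW True by (simp add: ln_div ln_mult)
  next
    case False
    have "1 / (2 * real (card Q) ^ n) \<le> \<omega> (w x)" by (simp add: \<omega>_def)
    then have "ln (1 / (2 * real (card Q) ^ n)) \<le> ln (\<omega> (w x))"
      using card_Q \<omega>_pos by (subst ln_le_cancel_iff) auto
    \<comment> \<open>For empty \<open>A\<close> this uses the default value
      \<open>ln 0 = 0\<close>.\<close>
    moreover have "0 \<le> ln (real (card W))" by (cases "card W = 0") auto
    ultimately show ?thesis using card_Q False x by (simp add: ln_div ln_mult ln_realpow)
  qed
  have \<rho>_bound: "- ln (\<rho> (c y) (cell_of P y)) \<le> - ln (1 - \<eta>) + indicator B y * ln (real (card P) / \<eta>)"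
    if y: "y \<in> space M" for y
  proof (cases "y \<in> B")
    case True
    have "\<eta> / real (card P) \<le> \<rho> (c y) (cell_of P y)" using \<eta> by (simp add: \<rho>_def)
    then have "ln (\<eta> / real (card P)) \<le> ln (\<rho> (c y) (cell_of P y))"
      using \<eta> card_P \<rho>_pos by (subst ln_le_cancel_iff) auto
    moreover have "ln (1 - \<eta>) \<le> 0" using \<eta> by simp
    moreover have "ln (real (card P) / \<eta>) = - ln (\<eta> / real (card P))"
      using \<eta> card_P by (simp add: ln_div)
    moreover have "indicator B y = (1 :: real)" using True by simp
    ultimately show ?thesis by simp
  next
    case False
    then have "cell_of P y = \<phi> (c y)" using y B(2) by blast
    then have "1 - \<eta> \<le> \<rho> (c y) (cell_of P y)" using \<eta> by (simp add: \<rho>_def)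
    then have "ln (1 - \<eta>) \<le> ln (\<rho> (c y) (cell_of P y))"
      using \<eta> \<rho>_pos by (subst ln_le_cancel_iff) auto
    then show ?thesis using False by simp
  qed
  have le_bound: "- ln (r (name x)) \<le> bound x" if x: "x \<in> space M" for x
  proof -
    have "ln (\<omega> (w x) * (\<Prod>i<n. \<rho> (c ((T ^^ i) x)) (cell_of P ((T ^^ i) x)))) \<le> ln (r (name x))"
      using r_ge[OF x] lower_pos by (subst ln_le_cancel_iff) (auto intro: less_le_trans)
    moreover have "ln (\<omega> (w x) * (\<Prod>i<n. \<rho> (c ((T ^^ i) x)) (cell_of P ((T ^^ i) x)))) =
        ln (\<omega> (w x)) + (\<Sum>i<n. ln (\<rho> (c ((T ^^ i) x)) (cell_of P ((T ^^ i) x))))"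
    proof -
      have "ln (\<Prod>i<n. \<rho> (c ((T ^^ i) x)) (cell_of P ((T ^^ i) x))) =
          (\<Sum>i<n. ln (\<rho> (c ((T ^^ i) x)) (cell_of P ((T ^^ i) x))))"
        by (rule ln_prod) (simp_all add: less_imp_neq[OF \<rho>_pos, symmetric])
      moreover have "0 < (\<Prod>i<n. \<rho> (c ((T ^^ i) x)) (cell_of P ((T ^^ i) x)))"
        using \<rho>_pos by (intro prod_pos) auto
      ultimately show ?thesis using ln_mult_pos[OF \<omega>_pos[of "w x"]] by simp
    qed
    moreover have "(\<Sum>i<n. - ln (\<rho> (c ((T ^^ i) x)) (cell_of P ((T ^^ i) x)))) \<le>
        (\<Sum>i<n. - ln (1 - \<eta>) + indicator B ((T ^^ i) x) * ln (real (card P) / \<eta>))"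
      using space[OF x] by (intro sum_mono \<rho>_bound) auto
    ultimately show ?thesis using \<omega>_bound[OF x] unfolding bound_def sum_negf by linarith
  qed
  have distr_n: "distr M M (T ^^ i) = M" for i
  proof (induction i)
    case (Suc i)
    have "distr M M (T ^^ Suc i) = distr (distr M M (T ^^ i)) M T" by (subst distr_distr) auto
    then show ?case using Suc distr by (simp add: o_def)
  qed (simp add: id_def distr_id2)
  have meas_B: "integral\<^sup>L M (\<lambda>x. indicator B ((T ^^ i) x)) = measure M B" for i
  proof -
    have "integral\<^sup>L M (\<lambda>x. indicator B ((T ^^ i) x) :: real) = integral\<^sup>L (distr M M (T ^^ i)) (indicator B)"
      using B(1) by (subst integral_distr) auto
    then show ?thesis using B(1) by (simp add: distr_n)
  qed
  have int_B: "integrable M (\<lambda>x. indicator B ((T ^^ i) x) :: real)" for i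
    using B(1) by (intro integrable_const_bound[where B = 1]) (auto simp: indicator_def)
  have int_A: "integrable M (\<lambda>x. indicator (space M - A) x :: real)"
    using A by (intro integrable_const_bound[where B = 1]) (auto simp: indicator_def)
  have int_C: "integrable M (\<lambda>x. indicator (C a) x * - ln (r a))" if "a \<in> N" for a
    using C_sets[OF that]
    by (intro integrable_mult_left integrable_const_bound[where B = 1]) (auto simp: indicator_def)
  have int_bound: "integrable M bound"
    unfolding bound_def using int_A int_B
    by (intro Bochner_Integration.integrable_add Bochner_Integration.integrable_sum integrable_mult_left) auto
  have "partition_entropy M (iterated_join M T P n) \<le> (\<Sum>a\<in>N. measure M (C a) * - ln (r a))"
    unfolding entropy using r_pos sum_C sum_r by (intro gibbs_inequality fin_N) auto
  also have "\<dots> = integral\<^sup>L M (\<lambda>x. \<Sum>a\<in>N. indicator (C a) x * - ln (r a))"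
    using C_sets sets.sets_into_space[OF C_sets]
    by (subst Bochner_Integration.integral_sum[OF int_C]) (auto simp: Int_absorb1 cong: sum.cong)
  also have "\<dots> \<le> integral\<^sup>L M bound"
  proof (rule integral_mono)
    fix x assume x: "x \<in> space M"
    then have "name x \<in> N" by (auto simp: N_def)
    have "(\<Sum>a\<in>N. indicator (C a) x * - ln (r a)) = (\<Sum>a\<in>N. if a = name x then - ln (r a) else 0)"
      using x by (intro sum.cong) (auto simp: C_def indicator_def)
    also have "\<dots> = - ln (r (name x))" using fin_N \<open>name x \<in> N\<close> by (simp add: sum.delta)
    finally show "(\<Sum>a\<in>N. indicator (C a) x * - ln (r a)) \<le> bound x" using le_bound[OF x] by simp
  qed (use int_C int_bound in \<open>auto intro: Bochner_Integration.integrable_sum\<close>)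
  also have "\<dots> = ln 2 + ln (real (card W)) + measure M (space M - A) * (real n * ln (real (card Q))) +
    (\<Sum>i<n. - ln (1 - \<eta>) + measure M B * ln (real (card P) / \<eta>))"
    unfolding bound_def using int_A int_B A
    by (simp add: meas_B prob_space Bochner_Integration.integral_add Bochner_Integration.integral_sum
        Bochner_Integration.integrable_add Bochner_Integration.integrable_sum integrable_mult_left)
  finally show ?thesis by (simp add: W_def w_def mult.assoc)
qed

subsection \<open>The weak-* topology and periodic measures\<close>

text \<open>The sets \<open>N F e\<close> form a neighbourhood base at \<mu>, by induction over the
  generation of open sets: an intersection unites the families and takes the smaller
  tolerance.\<close>

lemma in_weak_star_closure_ofI:
  assumes \<mu>: "\<mu> \<in> prob_measures"
    and approx: "\<And>(F :: (real \<Rightarrow> real) set) e. finite F \<Longrightarrow> (\<And>f. f \<in> F \<Longrightarrow> continuous_on {0..1} f) \<Longrightarrow> 0 < e \<Longrightarrow>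
      \<exists>\<nu>\<in>X \<inter> prob_measures. \<forall>f\<in>F. \<bar>integral\<^sup>L \<nu> f - integral\<^sup>L \<mu> f\<bar> < e"
  shows "\<mu> \<in> weak_star_topology closure_of X"
proof -
  let ?B = "{{\<mu> \<in> prob_measures. integral\<^sup>L \<mu> f \<in> U} | (f :: real \<Rightarrow> real) U.
    continuous_on {0..1} f \<and> open U}"
  define N where "N F e = {\<nu> \<in> prob_measures. \<forall>f\<in>F. \<bar>integral\<^sup>L \<nu> f - integral\<^sup>L \<mu> f\<bar> < e}"
    for F :: "(real \<Rightarrow> real) set" and e
  have "{\<mu> \<in> prob_measures. integral\<^sup>L \<mu> (\<lambda>_. 0 :: real) \<in> UNIV} \<in> ?B"
    using continuous_on_const open_UNIV by blast
  then have "\<mu> \<in> \<Union> ?B" using \<mu> by auto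
  then have top: "\<mu> \<in> topspace weak_star_topology"
    unfolding weak_star_topology_def topology_generated_by_topspace .
  have nbhd: "\<exists>F e. finite F \<and> (\<forall>f\<in>F. continuous_on {0..1} f) \<and> 0 < e \<and> N F e \<subseteq> U"
    if "generate_topology_on ?B U" "\<mu> \<in> U" for U
    using that
  proof (induction rule: generate_topology_on.induct)
    case (Int a b)
    then have ab: "\<mu> \<in> a" "\<mu> \<in> b" by auto
    obtain F e where F: "finite F" "\<forall>f\<in>F. continuous_on {0..1} f" "0 < e" "N F e \<subseteq> a"
      using Int.IH(1)[OF ab(1)] by blast
    obtain F' e' where F': "finite F'" "\<forall>f\<in>F'. continuous_on {0..1} f" "0 < e'" "N F' e' \<subseteq> b"
      using Int.IH(2)[OF ab(2)] by blast
    have "N (F \<union> F') (min e e') \<subseteq> a \<inter> b"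
      using F(4) F'(4) unfolding N_def by auto
    then show ?case using F F' by (intro exI[of _ "F \<union> F'"] exI[of _ "min e e'"]) auto
  next
    case (UN K)
    then obtain k where k: "k \<in> K" "\<mu> \<in> k" by blast
    have "k \<subseteq> \<Union>K" using k(1) by (rule Union_upper)
    with UN.IH[OF k] show ?case by (elim ex_forward conj_forward) (assumption | rule subset_trans)+
  next
    case (Basis s)
    then obtain f :: "real \<Rightarrow> real" and U where fU: "s = {\<mu> \<in> prob_measures. integral\<^sup>L \<mu> f \<in> U}" "continuous_on {0..1} f" "open U"
      by blast
    then have "integral\<^sup>L \<mu> f \<in> U" using Basis.prems by simp
    then obtain e where e: "e > 0" "\<And>y. dist y (integral\<^sup>L \<mu> f) < e \<Longrightarrow> y \<in> U"
      using fU(3) unfolding open_dist by blast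
    then have "N {f} e \<subseteq> s" unfolding N_def fU(1) by (auto simp: dist_real_def)
    then show ?case using fU(2) e(1) by (intro exI[of _ "{f}"] exI[of _ e]) auto
  qed auto
  show ?thesis
    unfolding in_closure_of
  proof (intro conjI top allI impI)
    fix U assume "\<mu> \<in> U \<and> openin weak_star_topology U"
    then have U: "\<mu> \<in> U" "generate_topology_on ?B U"
      unfolding weak_star_topology_def openin_topology_generated_by_iff by auto
    obtain F e where F: "finite F" "\<forall>f\<in>F. continuous_on {0..1} f" "0 < e" "N F e \<subseteq> U"
      using nbhd[OF U(2,1)] by blast
    obtain \<nu> where "\<nu> \<in> X" "\<nu> \<in> N F e" using F(1-3) approx[of F e] unfolding N_def by auto
    then show "\<exists>y. y \<in> X \<and> y \<in> U" using F(4) by blast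
  qed
qed

text \<open>Pushing forward the uniform distribution on times turns integrals into orbit averages
  and counts repeated visits with multiplicity, so any period \<open>n\<close> will do.\<close>

definition orbit_measure :: "(real \<Rightarrow> real) \<Rightarrow> nat \<Rightarrow> real \<Rightarrow> real measure" where
  "orbit_measure T n p = distr (measure_pmf (pmf_of_set {..<n})) unit_borel (\<lambda>j. (T ^^ j) p)"

lemma
  assumes T: "\<And>j. (T ^^ j) p \<in> {0..1}" and n: "0 < n"
  shows orbit_measure_prob: "orbit_measure T n p \<in> prob_measures"
    and integral_orbit_measure: "f \<in> borel_measurable unit_borel \<Longrightarrow>
      integral\<^sup>L (orbit_measure T n p) f = (\<Sum>j<n. f ((T ^^ j) p)) / real n"
    and orbit_measure_periodic: "(T ^^ n) p = p \<Longrightarrow> orbit_measure T n p \<in> periodic_measures T"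
proof -
  have meas: "(\<lambda>j. (T ^^ j) p) \<in> measurable (measure_pmf (pmf_of_set {..<n})) unit_borel"
    using T by (auto intro!: measurable_restrict_space2)
  interpret P: prob_space "orbit_measure T n p"
    unfolding orbit_measure_def using meas by (rule measure_pmf.prob_space_distr)
  show prob: "orbit_measure T n p \<in> prob_measures"
    using P.prob_space_axioms by (simp add: prob_measures_def orbit_measure_def)
  show int: "integral\<^sup>L (orbit_measure T n p) f = (\<Sum>j<n. f ((T ^^ j) p)) / real n"
    if "f \<in> borel_measurable unit_borel" for f :: "real \<Rightarrow> real"
    unfolding orbit_measure_def using n that
    by (subst integral_distr[OF meas]) (auto simp: integral_pmf_of_set lessThan_empty_iff)
  show "orbit_measure T n p \<in> periodic_measures T" if "(T ^^ n) p = p"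
  proof -
    have "measure (orbit_measure T n p) A =
        1 / real n * (\<Sum>j<n. measure (return unit_borel ((T ^^ j) p)) A)"
      if "A \<in> sets (orbit_measure T n p)" for A
    proof -
      have A: "A \<in> sets unit_borel" using that by (simp add: orbit_measure_def)
      have "measure (orbit_measure T n p) A = integral\<^sup>L (orbit_measure T n p) (indicator A)"
        using that by simp
      also have "\<dots> = (\<Sum>j<n. indicator A ((T ^^ j) p)) / real n"
        using A by (intro int) simp
      finally show ?thesis using A by (simp add: measure_return)
    qed
    then show ?thesis
      using prob T[of 0] n that unfolding periodic_measures_def by auto
  qed
qed

subsection \<open>Approximation by periodic orbits\<close>

text \<open>Each shift drops one term, negligible after division by \<open>n\<close>. This is needed
  because the periodic orbit shadows that of \<open>x\<close> only from a later time on.\<close>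

lemma averages_shift:
  fixes f :: "'a \<Rightarrow> real"
  assumes "(\<lambda>n. (\<Sum>i<n. f ((T ^^ i) x)) / real n) \<longlonglongrightarrow> l"
  shows "(\<lambda>n. (\<Sum>i<n. f ((T ^^ i) ((T ^^ k) x))) / real n) \<longlonglongrightarrow> l"
proof (induction k)
  case (Suc k)
  let ?y = "(T ^^ k) x"
  let ?S = "\<lambda>n. \<Sum>i<n. f ((T ^^ i) ?y)"
  have "(\<lambda>n. ?S (Suc n) / real (Suc n)) \<longlonglongrightarrow> l" using Suc by (rule LIMSEQ_Suc)
  moreover have "(\<lambda>n. real (Suc n) / real n) \<longlonglongrightarrow> 1" by (rule LIMSEQ_Suc_n_over_n)
  moreover have "(\<lambda>n. f ?y / real n) \<longlonglongrightarrow> 0" by (rule lim_const_over_n)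
  ultimately have "(\<lambda>n. ?S (Suc n) / real (Suc n) * (real (Suc n) / real n) - f ?y / real n) \<longlonglongrightarrow> l * 1 - 0"
    by (intro tendsto_diff tendsto_mult)
  moreover have "\<forall>\<^sub>F n in sequentially. ?S (Suc n) / real (Suc n) * (real (Suc n) / real n) - f ?y / real n =
      (\<Sum>i<n. f ((T ^^ i) ((T ^^ Suc k) x))) / real n"
  proof (rule eventually_sequentiallyI[of 1])
    fix n :: nat assume n: "1 \<le> n"
    have "?S (Suc n) / real (Suc n) * (real (Suc n) / real n) - f ?y / real n = (?S (Suc n) - f ?y) / real n"
      using n by (simp add: diff_divide_distrib del: sum.lessThan_Suc)
    then show "?S (Suc n) / real (Suc n) * (real (Suc n) / real n) - f ?y / real n =
      (\<Sum>i<n. f ((T ^^ i) ((T ^^ Suc k) x))) / real n"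
      unfolding birkhoff_sum_Suc by simp
  qed
  ultimately show ?case by (simp add: filterlim_cong[OF refl refl])
qed (use assms in simp)

context coded_interval_map
begin

text \<open>The pigeonhole principle fixes \<open>s\<close> and leaves infinitely many
  \<open>n\<close>. The shadowed segment then starts at the fixed time \<open>s + m\<close> while
  its length \<open>n - s\<close> grows, so its averages converge; shadowing costs the other
  \<open>e / 2\<close>.\<close>

lemma periodic_point_of_infinitely_many_splits:
  fixes F :: "(real \<Rightarrow> real) set" and l :: "(real \<Rightarrow> real) \<Rightarrow> real"
  assumes x: "x \<in> {0..1}" and inf: "infinite {n. splits n (n + m) x}"
    and F: "finite F" and e: "e > 0"
    and avg: "\<And>f. f \<in> F \<Longrightarrow> (\<lambda>n. (\<Sum>i<n. f ((T ^^ i) x)) / real n) \<longlonglongrightarrow> l f"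
    and mesh: "\<And>f y z. \<lbrakk>f \<in> F; y \<in> {0..1}; z \<in> {0..1}; code y = code z\<rbrakk> \<Longrightarrow> \<bar>f y - f z\<bar> \<le> e / 2"
  obtains p n where "p \<in> {0..1}" "0 < n" "(T ^^ n) p = p"
    "\<And>f. f \<in> F \<Longrightarrow> \<bar>(\<Sum>i<n. f ((T ^^ i) p)) / real n - l f\<bar> < e"
proof -
  let ?N = "{n. splits n (n + m) x}"
  have "finite ((\<lambda>n. itin m ((T ^^ n) x)) ` ?N)"
    by (rule finite_subset[OF _ finite_words[of m UNIV]]) auto
  from pigeonhole_infinite[OF inf this] obtain s
    where s: "s \<in> ?N" "infinite {n \<in> ?N. itin m ((T ^^ n) x) = itin m ((T ^^ s) x)}" by blast
  let ?y = "(T ^^ (s + m)) x"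
  have "\<forall>\<^sub>F n in sequentially. \<forall>f\<in>F. \<bar>(\<Sum>i<n. f ((T ^^ i) ?y)) / real n - l f\<bar> < e / 2"
  proof (rule eventually_ball_finite[OF F], rule ballI)
    fix f assume "f \<in> F"
    then have "(\<lambda>n. (\<Sum>i<n. f ((T ^^ i) ?y)) / real n) \<longlonglongrightarrow> l f" by (intro averages_shift avg)
    then show "\<forall>\<^sub>F n in sequentially. \<bar>(\<Sum>i<n. f ((T ^^ i) ?y)) / real n - l f\<bar> < e / 2"
      using e by (auto simp: tendsto_iff dist_real_def dest: spec[of _ "e / 2"])
  qed
  then obtain n0 where n0: "\<And>n f. n0 \<le> n \<Longrightarrow> f \<in> F \<Longrightarrow> \<bar>(\<Sum>i<n. f ((T ^^ i) ?y)) / real n - l f\<bar> < e / 2"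
    unfolding eventually_sequentially by blast
  \<comment> \<open>Closing the orbit requires \<open>s + m \<le> n\<close>, accurate averages
    require \<open>n0 \<le> n - s\<close>, and the 1 makes the period positive.\<close>
  obtain n where n: "n0 + s + m + 1 \<le> n" "splits n (n + m) x" "itin m ((T ^^ s) x) = itin m ((T ^^ n) x)"
    using s(2)[unfolded infinite_nat_iff_unbounded_le, rule_format, of "n0 + s + m + 1"] by fastforce
  obtain p where p: "p \<in> {0..1}" "(T ^^ (n - s)) p = p" "itin (n - s) p = itin (n - s) ?y"
    using periodic_point_of_splits[OF x _ n(2,3)] n(1) by auto
  have "\<bar>(\<Sum>i<n - s. f ((T ^^ i) p)) / real (n - s) - l f\<bar> < e" if f: "f \<in> F" for f
  proof -
    have "\<bar>(\<Sum>i<n - s. f ((T ^^ i) p)) - (\<Sum>i<n - s. f ((T ^^ i) ?y))\<bar> \<le>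
        (\<Sum>i<n - s. \<bar>f ((T ^^ i) p) - f ((T ^^ i) ?y)\<bar>)"
      unfolding sum_subtractf[symmetric] by (rule sum_abs)
    also have "\<dots> \<le> (\<Sum>i<n - s. e / 2)"
      using p(3) f funpow_unit[OF p(1)] funpow_unit[OF funpow_unit[OF x]] unfolding itin_eq_iff
      by (intro sum_mono mesh) auto
    finally have "\<bar>(\<Sum>i<n - s. f ((T ^^ i) p)) / real (n - s) - (\<Sum>i<n - s. f ((T ^^ i) ?y)) / real (n - s)\<bar> \<le> e / 2"
      using n(1) by (simp add: diff_divide_distrib[symmetric] divide_le_eq mult.commute)
    moreover have "\<bar>(\<Sum>i<n - s. f ((T ^^ i) ?y)) / real (n - s) - l f\<bar> < e / 2"
      using n(1) f by (intro n0) auto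
    moreover have "\<bar>a - c\<bar> < e" if "\<bar>a - b\<bar> \<le> e / 2" "\<bar>b - c\<bar> < e / 2" for a b c
      using that by linarith
    ultimately show ?thesis by blast
  qed
  moreover have "0 < n - s" using n(1) by simp
  ultimately show ?thesis using that[of p "n - s"] p(1,2) by blast
qed

text \<open>The witnesses have other \<open>t\<close>-words and so cannot lie between
  \<open>x\<close> and \<open>x'\<close>. Splitting therefore depends on the \<open>t\<close>-word
  only, and the points that split form a finite union of cylinders.\<close>

lemma splits_cong:
  assumes xx': "x \<in> {0..1}" "x' \<in> {0..1}" "itin t x = itin t x'" and nt: "n \<le> t" and sp: "splits n t x"
  shows "splits n t x'"
proof -
  obtain y z where y: "0 \<le> y" "y < x" "itin n y = itin n x" "itin t y \<noteq> itin t x"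
    and z: "x < z" "z \<le> 1" "itin n z = itin n x" "itin t z \<noteq> itin t x"
    using sp unfolding splits_def by auto
  have "y < x'"
  proof (rule ccontr)
    assume "\<not> y < x'"
    then have "y \<in> closed_segment x x'" using y by (auto simp: closed_segment_eq_real_ivl)
    then show False using itin_segment(3)[OF xx'] y(4) by blast
  qed
  moreover have "x' < z"
  proof (rule ccontr)
    assume "\<not> x' < z"
    then have "z \<in> closed_segment x x'" using z by (auto simp: closed_segment_eq_real_ivl)
    then show False using itin_segment(3)[OF xx'] z(4) by blast
  qed
  moreover have "itin n x = itin n x'" using xx'(3) nt by (rule itin_eq_mono)
  ultimately show ?thesis using y z xx'(3) unfolding splits_def by (intro bexI[of _ y] bexI[of _ z]) auto
qed

lemma code_measurable:
  assumes [measurable]: "f \<in> borel_measurable M"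
  shows "{x \<in> space M. code (f x) = q} \<in> sets M"
proof -
  have "{x \<in> space M. code (f x) = q} =
      {x \<in> space M. fst q \<subseteq> S \<and> snd q \<subseteq> S \<and> (\<forall>s\<in>S. (s < f x \<longleftrightarrow> s \<in> fst q) \<and> (s \<le> f x \<longleftrightarrow> s \<in> snd q))}"
    unfolding code_def by (cases q) auto
  also have "\<dots> \<in> sets M" using finite_S by (intro sets.sets_Collect) auto
  finally show ?thesis .
qed

lemma splits_measurable:
  assumes sets: "sets M = sets unit_borel" and [measurable]: "T \<in> M \<rightarrow>\<^sub>M M" and nt: "n \<le> t"
  shows "{x \<in> space M. splits n t x} \<in> sets M"
proof -
  have space: "space M = {0..1}" using sets_eq_imp_space_eq[OF sets] by (simp add: space_restrict_space)
  have id: "(\<lambda>x. x) \<in> borel_measurable M"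
    unfolding measurable_cong_sets[OF sets refl] by (rule measurable_restrict_space1) simp
  have it [measurable]: "(\<lambda>x. (T ^^ i) x) \<in> borel_measurable M" for i
    by (rule measurable_compose[OF _ id]) measurable
  have itin: "{x \<in> space M. itin t x = w} \<in> sets M" for w
  proof -
    have "{x \<in> space M. itin t x = w} =
        {x \<in> space M. length w = t \<and> (\<forall>i\<in>{..<t}. code ((T ^^ i) x) = w ! i)}"
      by (auto simp: list_eq_iff_nth_eq) (auto simp: itin_def)
    also have "\<dots> \<in> sets M"
      by (intro sets.sets_Collect_conj sets.sets_Collect_const sets.sets_Collect_finite_All code_measurable it) auto
    finally show ?thesis .
  qed
  have "{x \<in> space M. splits n t x} = (\<Union>w\<in>itin t ` {x \<in> {0..1}. splits n t x}. {x \<in> space M. itin t x = w})"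
  proof (intro equalityI subsetI)
    fix x assume "x \<in> (\<Union>w\<in>itin t ` {x \<in> {0..1}. splits n t x}. {x \<in> space M. itin t x = w})"
    then obtain x' where "x' \<in> {0..1}" "splits n t x'" "x \<in> space M" "itin t x' = itin t x" by auto
    then show "x \<in> {x \<in> space M. splits n t x}" using splits_cong[OF _ _ _ nt] space by blast
  qed (use space in auto)
  also have "\<dots> \<in> sets M" using finite_words itin by (intro sets.finite_UN) auto
  finally show ?thesis .
qed

end

section \<open>Entropy when almost every point splits only finitely often\<close>

context coded_interval_map
begin

text \<open>One third of \<epsilon> each pays for the growth of the words of \<open>G k\<close>, for
  the points outside \<open>G k\<close>, and for the constants divided by \<open>n\<close>. The
  remaining term measures how far the code is from determining the cell.\<close>

lemma eventually_partition_entropy_le: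
  assumes "prob_space M" and sets: "sets M = sets unit_borel" and mp: "measure_preserving M T"
    and P: "finite_measurable_partition M P"
    and rare: "\<And>m. AE x in M. finite {n. splits n (n + m) x}"
    and e: "\<epsilon> > 0" and \<eta>: "0 < \<eta>" "\<eta> < 1"
    and B: "B \<in> sets M" "\<And>x. x \<in> space M - B \<Longrightarrow> cell_of P x = \<phi> (code x)"
  shows "\<forall>\<^sub>F n in sequentially. partition_entropy M (iterated_join M T P n) / real n \<le>
    \<epsilon> + (- ln (1 - \<eta>) + measure M B * ln (real (card P) / \<eta>))"
proof -
  interpret prob_space M by fact
  have space: "space M = {0..1}" using sets_eq_imp_space_eq[OF sets] by (simp add: space_restrict_space)
  have T: "T \<in> M \<rightarrow>\<^sub>M M" using mp by (simp add: measure_preserving_def)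
  define \<theta> where "\<theta> = exp (\<epsilon> / 3)"
  have \<theta>: "\<theta> > 1" "ln \<theta> = \<epsilon> / 3" using e by (auto simp: \<theta>_def)
  define D where "D = 3 * real (card S)"
  have "0 \<le> D" by (simp add: D_def)
  \<comment> \<open>\<open>D\<close> depends on \<open>S\<close> only, so the depth can be chosen to
    beat it; taking \<open>Suc m0\<close> makes it positive.\<close>
  obtain m0 where "D * \<theta> / (\<theta> - 1) < \<theta> ^ m0" using real_arch_pow[OF \<theta>(1)] by blast
  also have "\<theta> ^ m0 \<le> \<theta> ^ Suc m0" using \<theta>(1) by (intro power_increasing) auto
  finally have "D * \<theta> \<le> (\<theta> - 1) * \<theta> ^ Suc m0" using \<theta>(1) by (simp add: divide_less_eq mult.commute)
  then obtain m where m: "D * \<theta> \<le> (\<theta> - 1) * \<theta> ^ m" "0 < m" by blast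
  define G where "G k = {x \<in> space M. \<forall>n\<in>{k..}. \<not> splits n (n + m) x}" for k
  have G_eq: "G k = space M - (\<Union>n\<in>{k..}. {x \<in> space M. splits n (n + m) x})" for k
    unfolding G_def by auto
  have G_sets: "G k \<in> sets M" for k
    unfolding G_eq using splits_measurable[OF sets T]
    by (intro sets.Diff sets.top sets.countable_UN') (auto intro: countable_subset)
  have "(\<lambda>k. measure M (G k)) \<longlonglongrightarrow> measure M (\<Union>k. G k)"
    using G_sets by (intro finite_Lim_measure_incseq) (auto simp: incseq_def G_def)
  moreover have "measure M (\<Union>k. G k) = 1"
  proof -
    have "AE x in M. x \<in> (\<Union>k. G k)"
      using rare[of m] AE_space
    proof eventually_elim
      case (elim x)
      then obtain k where "\<forall>n\<in>{n. splits n (n + m) x}. n < k" using finite_nat_set_iff_bounded by blast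
      then have "x \<in> G k" using elim unfolding G_def by force
      then show ?case by blast
    qed
    then show ?thesis using G_sets by (intro prob_eq_1[THEN iffD2]) auto
  qed
  ultimately have "(\<lambda>k. (1 - measure M (G k)) * ln (real (card codes))) \<longlonglongrightarrow> (1 - 1) * ln (real (card codes))"
    by (intro tendsto_intros) simp
  then have "\<forall>\<^sub>F k in sequentially. (1 - measure M (G k)) * ln (real (card codes)) < \<epsilon> / 3"
    using e by (intro order_tendstoD(2)) auto
  then obtain k where k: "(1 - measure M (G k)) * ln (real (card codes)) < \<epsilon> / 3"
    using eventually_happens trivial_limit_sequentially by blast
  have "\<exists>C>0. \<forall>t. real (card (itin t ` G k)) \<le> C * \<theta> ^ t"
  proof (rule delayed_recursion_growth[OF \<theta>(1) \<open>0 \<le> D\<close> m(1) _ m(2)])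
    fix t assume t: "k + m \<le> t" "m \<le> t"
    have "card (itin t ` G k) \<le> 3 * card S * (\<Sum>i\<le>t - m. card (itin i ` G k))"
    proof (rule card_words_not_splits)
      fix x assume "x \<in> G k"
      moreover have "t - m \<in> {k..}" using t by simp
      ultimately have "\<not> splits (t - m) (t - m + m) x" unfolding G_def by blast
      then show "\<not> splits (t - m) t x" using t by simp
    qed (use t space in \<open>auto simp: G_def\<close>)
    then have "real (card (itin t ` G k)) \<le> real (3 * card S * (\<Sum>i\<le>t - m. card (itin i ` G k)))"
      by (rule of_nat_mono)
    then show "real (card (itin t ` G k)) \<le> D * (\<Sum>i\<le>t - m. real (card (itin i ` G k)))"
      by (simp add: D_def)
  qed
  then obtain C where C: "0 < C" "\<And>t. real (card (itin t ` G k)) \<le> C * \<theta> ^ t" by blast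
  \<comment> \<open>At least 1, so that the logarithmic bound also holds when there are no words and
    \<open>ln 0 = 0\<close>.\<close>
  define C' where "C' = max C 1"
  have ln_card: "ln (real (card (itin t ` G k))) \<le> ln C' + real t * (\<epsilon> / 3)" for t
  proof (cases "card (itin t ` G k) = 0")
    case True
    then show ?thesis using e by (simp add: C'_def)
  next
    case False
    have "C * \<theta> ^ t \<le> C' * \<theta> ^ t" using \<theta>(1) by (intro mult_right_mono) (auto simp: C'_def)
    with C(2)[of t] have "real (card (itin t ` G k)) \<le> C' * \<theta> ^ t" by (rule order_trans)
    then have "ln (real (card (itin t ` G k))) \<le> ln (C' * \<theta> ^ t)"
      using False by (intro ln_mono) auto
    also have "\<dots> = ln C' + real t * (\<epsilon> / 3)"
      using \<theta> by (subst ln_mult_pos) (auto simp: C'_def ln_realpow)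
    finally show ?thesis .
  qed
  have "(\<lambda>n. (ln 2 + ln C') / real n) \<longlonglongrightarrow> 0" by (rule lim_const_over_n)
  then have "\<forall>\<^sub>F n in sequentially. (ln 2 + ln C') / real n < \<epsilon> / 3"
    using e by (intro order_tendstoD(2)) auto
  then show ?thesis
    using eventually_gt_at_top[of 0]
  proof eventually_elim
    case (elim n)
    define R where "R = - ln (1 - \<eta>) + measure M B * ln (real (card P) / \<eta>)"
    have "partition_entropy M (iterated_join M T P n) \<le>
      ln 2 + ln (real (card (itin n ` G k))) + measure M (space M - G k) * real n * ln (real (card codes)) +
      real n * R"
      unfolding R_def itin_def[abs_def]
      by (rule partition_entropy_iterated_join_le[OF assms(1) mp P elim(2) finite_codes _ G_sets \<eta> B])
        (rule code_in_codes)
    also have "measure M (space M - G k) = 1 - measure M (G k)"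
      using G_sets by (rule prob_compl)
    also have "(1 - measure M (G k)) * real n * ln (real (card codes)) =
        real n * ((1 - measure M (G k)) * ln (real (card codes)))" by simp
    also have "\<dots> \<le> real n * (\<epsilon> / 3)" using k by (intro mult_left_mono) auto
    finally have "partition_entropy M (iterated_join M T P n) \<le>
        (ln 2 + ln C') + real n * (2 * \<epsilon> / 3 + R)"
      using ln_card[of n] by (simp add: algebra_simps)
    then have "partition_entropy M (iterated_join M T P n) / real n \<le>
        ((ln 2 + ln C') + real n * (2 * \<epsilon> / 3 + R)) / real n"
      by (rule divide_right_mono) simp
    also have "\<dots> = (ln 2 + ln C') / real n + (2 * \<epsilon> / 3 + R)"
      using elim(2) by (simp add: add_divide_distrib)
    finally show ?case using elim(1) unfolding R_def by linarith
  qed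
qed

end

subsection \<open>Codings of piecewise monotonic maps\<close>

text \<open>The cut points in \<open>S\<close> provide continuity and injectivity, the grid of step
  \<open>1 / K\<close> provides the mesh.\<close>

lemma piecewise_monotonic_coding:
  assumes T: "piecewise_monotonic T" and d: "\<delta> > 0"
  obtains S where "coded_interval_map T S"
    "\<And>y z. \<lbrakk>y \<in> {0..1}; z \<in> {0..1}; coded_interval_map.code S y = coded_interval_map.code S z\<rbrakk> \<Longrightarrow> \<bar>y - z\<bar> < \<delta>"
proof -
  obtain N :: nat and c where c: "c 0 = 0" "c N = 1"
    "\<And>i. i \<in> {1..N} \<Longrightarrow> continuous_on {c (i - 1)<..<c i} T \<and>
       (strict_mono_on {c (i - 1)<..<c i} T \<or> strict_antimono_on {c (i - 1)<..<c i} T)"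
    using T unfolding piecewise_monotonic_def by blast
  obtain K :: nat where K: "1 / \<delta> < real K" using reals_Archimedean2 by blast
  then have "0 < K" using d by (intro gr0I) (auto simp: less_le_trans)
  then have K': "1 / real K < \<delta>" using K d by (simp add: field_simps)
  define S where "S = c ` {..N} \<union> (\<lambda>i. real i / real K) ` {..K}"
  have S01: "0 \<in> S" "1 \<in> S" using c(1,2) unfolding S_def by force+
  have coded: "coded_interval_map T S"
  proof
    show "T x \<in> {0..1}" if "x \<in> {0..1}" for x
      using T that unfolding piecewise_monotonic_def
      by (auto dest!: measurable_space simp: space_restrict_space)
    fix y z :: real assume yz: "0 \<le> y" "y \<le> z" "z \<le> 1" "{y..z} \<inter> S = {}"
    define i where "i = (LEAST i. y \<le> c i)"
    have yN: "y \<le> c N" using yz c(2) by simp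
    then have i: "y \<le> c i" "i \<le> N" unfolding i_def by (auto intro: LeastI Least_le)
    have "y \<noteq> 0" using yz S01 by auto
    then have "i \<noteq> 0" using i(1) yz(1) c(1) by (metis order_antisym)
    then have "c (i - 1) < y" using not_less_Least[of "i - 1" "\<lambda>i. y \<le> c i"] unfolding i_def[symmetric] by auto
    moreover have "z < c i"
    proof (rule ccontr)
      assume "\<not> z < c i"
      then have "c i \<in> {y..z} \<inter> S" using i by (auto simp: S_def)
      then show False using yz(4) by blast
    qed
    ultimately have sub: "{y..z} \<subseteq> {c (i - 1)<..<c i}" by auto
    have "i \<in> {1..N}" using \<open>i \<noteq> 0\<close> i(2) by auto
    have inj: "inj_on T A" if "strict_mono_on A T \<or> strict_antimono_on A T" for A
      using that unfolding inj_on_def monotone_on_def by (metis less_irrefl linorder_less_linear)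
    have "continuous_on {c (i - 1)<..<c i} T" "inj_on T {c (i - 1)<..<c i}"
      using c(3)[OF \<open>i \<in> {1..N}\<close>] inj by blast+
    then show "continuous_on {y..z} T \<and> inj_on T {y..z}"
      using sub by (meson continuous_on_subset inj_on_subset)
  qed (use S01 in \<open>auto simp: S_def\<close>)
  interpret coded_interval_map T S by (rule coded)
  have close: "z - y < \<delta>" if "y < z" "code y = code z" "0 \<le> y" "z \<le> 1" for y z
  proof -
    \<comment> \<open>Gives the last grid point not above \<open>z\<close>; it cannot lie in
      \<open>{y..z}\<close>, so it lies below \<open>y\<close>.\<close>
    define i where "i = nat \<lfloor>z * real K\<rfloor>"
    have "0 \<le> z * real K" using that by simp
    then have i: "real i \<le> z * real K" "z * real K < real i + 1" unfolding i_def by linarith+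
    have "z * real K \<le> 1 * real K" using that by (intro mult_right_mono) auto
    then have "i \<le> K" using i(1) by linarith
    then have "real i / real K \<in> S" unfolding S_def by blast
    moreover have "{y..z} \<inter> S = {}" using that(2) code_eq_iff_less[OF that(1)] by simp
    ultimately have "real i / real K \<notin> {y..z}" by blast
    moreover have "real i / real K \<le> z" using i(1) \<open>0 < K\<close> by (simp add: divide_le_eq)
    ultimately have "real i / real K < y" by simp
    moreover have "z < real i / real K + 1 / real K"
      using i(2) \<open>0 < K\<close> by (simp add: add_divide_distrib[symmetric] less_divide_eq)
    ultimately show ?thesis using K' by linarith
  qed
  have "\<bar>y - z\<bar> < \<delta>" if "y \<in> {0..1}" "z \<in> {0..1}" "code y = code z" for y z
  proof (cases y z rule: linorder_cases)
    case less
    then show ?thesis using close[OF less] that by simp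
  next
    case greater
    then show ?thesis using close[OF greater] that by simp
  qed (use d in simp)
  then show ?thesis by (rule that[OF coded])
qed

subsection \<open>Approximating partitions\<close>

text \<open>Inner regularity of finite Borel measures on the line, applied to the image of
  \<open>M\<close> under the inclusion of the unit interval.\<close>

lemma inner_compact_approximation:
  assumes "prob_space M" and sets: "sets M = sets unit_borel" and p: "p \<in> sets M" and e: "e > 0"
  obtains K where "compact K" "K \<subseteq> p" "K \<in> sets M" "measure M (p - K) < e"
proof -
  interpret prob_space M by fact
  have id: "(\<lambda>x. x) \<in> borel_measurable M"
    unfolding measurable_cong_sets[OF sets refl] by (rule measurable_restrict_space1) simp
  have sets_iff: "A \<in> sets M \<longleftrightarrow> A \<subseteq> {0..1} \<and> A \<in> sets borel" for A
    unfolding sets by (simp add: sets_restrict_space_iff)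
  have space: "space M = {0..1}" using sets_eq_imp_space_eq[OF sets] by (simp add: space_restrict_space)
  define M' where "M' = distr M borel (\<lambda>x. x)"
  interpret M': prob_space M' unfolding M'_def using id by (rule prob_space_distr)
  have eq: "emeasure M' A = emeasure M A" if "A \<in> sets M" for A
  proof -
    have "A \<in> sets borel" "A \<inter> space M = A" using that unfolding sets_iff space by auto
    then show ?thesis unfolding M'_def using id by (simp add: emeasure_distr vimage_def)
  qed
  show ?thesis
  \<comment> \<open>\<open>ennreal\<close> truncates negative numbers to 0, so sets of measure below
    \<open>e\<close> are treated separately, with the empty set as \<open>K\<close>.\<close>
  proof (cases "measure M p < e")
    case True
    then show ?thesis using that[of "{}"] by simp
  next
    case False
    have "ennreal (measure M p - e) < emeasure M' p"
      using False e by (simp add: eq[OF p] emeasure_eq_measure ennreal_less_iff)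
    also have "\<dots> = (SUP K \<in> {K. K \<subseteq> p \<and> compact K}. emeasure M' K)"
      using p sets_iff M'.emeasure_finite by (intro inner_regular) (auto simp: M'_def)
    finally obtain K where K: "K \<subseteq> p" "compact K" "ennreal (measure M p - e) < emeasure M' K"
      unfolding less_SUP_iff by auto
    have K_sets: "K \<in> sets M"
      using K p unfolding sets_iff by (auto intro: borel_compact)
    then have "measure M p - e < measure M K"
      using K(3) False by (simp add: eq emeasure_eq_measure ennreal_less_iff)
    then have "measure M (p - K) < e"
      using finite_measure_Diff[OF p K_sets K(1)] by simp
    then show ?thesis using that K K_sets by blast
  qed
qed

text \<open>Disjoint compact sets have positive distance. Shrinking each cell to a compact set loses
  only the small set \<open>E\<close>, and outside it points closer than the least distance share
  their cell.\<close>

lemma partition_locally_constant: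
  assumes "prob_space M" and sets: "sets M = sets unit_borel"
    and P: "finite_measurable_partition M P" and b: "\<beta> > 0"
  obtains E \<delta> where "E \<in> sets M" "measure M E < \<beta>" "\<delta> > 0"
    "\<And>y z. \<lbrakk>y \<in> space M - E; z \<in> space M - E; \<bar>y - z\<bar> < \<delta>\<rbrakk> \<Longrightarrow> cell_of P y = cell_of P z"
proof -
  interpret prob_space M by fact
  have P': "finite P" "P \<subseteq> sets M" "partition_on (space M) P"
    using P by (auto simp: finite_measurable_partition_def)
  define e where "e = \<beta> / (1 + real (card P))"
  have e: "e > 0" using b by (simp add: e_def)
  have "\<exists>K. compact K \<and> K \<subseteq> p \<and> K \<in> sets M \<and> measure M (p - K) < e" if "p \<in> P" for p
  proof -
    have "p \<in> sets M" using that P'(2) by blast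
    from inner_compact_approximation[OF assms(1) sets this e] show ?thesis by metis
  qed
  then obtain K where K: "\<And>p. p \<in> P \<Longrightarrow> compact (K p)" "\<And>p. p \<in> P \<Longrightarrow> K p \<subseteq> p"
    "\<And>p. p \<in> P \<Longrightarrow> K p \<in> sets M" "\<And>p. p \<in> P \<Longrightarrow> measure M (p - K p) < e" by metis
  define E where "E = (\<Union>p\<in>P. p - K p)"
  have E: "E \<in> sets M" unfolding E_def using P'(1,2) K(3) by (intro sets.finite_UN sets.Diff) auto
  have "measure M E \<le> (\<Sum>p\<in>P. measure M (p - K p))"
    unfolding E_def using P'(1,2) K(3) by (intro finite_measure_subadditive_finite) auto
  also have "\<dots> \<le> (\<Sum>p\<in>P. e)" using K(4) by (intro sum_mono less_imp_le)
  also have "\<dots> < \<beta>" using b by (simp add: e_def field_simps)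
  finally have E_less: "measure M E < \<beta>" .
  have "\<exists>d>0. p \<noteq> q \<longrightarrow> (\<forall>x\<in>K p. \<forall>y\<in>K q. d \<le> dist x y)" if "p \<in> P" "q \<in> P" for p q
  proof (cases "p = q")
    case False
    then have "p \<inter> q = {}" using partition_onD2[OF P'(3)] that by (auto dest: disjointD)
    then have "K p \<inter> K q = {}" using K(2) that by blast
    then show ?thesis using separate_compact_closed[OF K(1) compact_imp_closed[OF K(1)]] that by blast
  qed (auto intro: exI[of _ 1])
  then obtain d where d: "\<And>p q. p \<in> P \<Longrightarrow> q \<in> P \<Longrightarrow> d p q > 0"
    "\<And>p q x y. p \<in> P \<Longrightarrow> q \<in> P \<Longrightarrow> p \<noteq> q \<Longrightarrow> x \<in> K p \<Longrightarrow> y \<in> K q \<Longrightarrow> d p q \<le> dist x y"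
    by metis
  define \<delta> where "\<delta> = Min (insert 1 ((\<lambda>(p, q). d p q) ` (P \<times> P)))"
  have \<delta>: "\<delta> > 0" unfolding \<delta>_def using P'(1) d(1) by (subst Min_gr_iff) auto
  have \<delta>_le: "\<delta> \<le> d p q" if "p \<in> P" "q \<in> P" for p q
    unfolding \<delta>_def using P'(1) that by (intro Min_le) auto
  have "cell_of P y = cell_of P z" if y: "y \<in> space M - E" and z: "z \<in> space M - E" and yz: "\<bar>y - z\<bar> < \<delta>" for y z
  proof (rule ccontr)
    assume neq: "cell_of P y \<noteq> cell_of P z"
    have cells: "cell_of P y \<in> P" "cell_of P z \<in> P" using cell_of[OF P'(3)] y z by auto
    have "y \<in> K (cell_of P y)" "z \<in> K (cell_of P z)"
      using cell_of[OF P'(3)] y z unfolding E_def by blast+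
    then have "d (cell_of P y) (cell_of P z) \<le> dist y z" using d(2) cells neq by blast
    then show False using \<delta>_le[OF cells] yz by (simp add: dist_real_def)
  qed
  then show ?thesis using that E E_less \<delta> by blast
qed

subsection \<open>Vanishing entropy in the absence of approximating periodic orbits\<close>

lemma partition_entropy_nonneg:
  assumes "prob_space M"
  shows "0 \<le> partition_entropy M P"
proof -
  interpret prob_space M by fact
  have "measure M B * ln (measure M B) \<le> 0" for B
    by (cases "measure M B = 0") (auto intro: mult_nonneg_nonpos simp: less_le)
  then show ?thesis unfolding partition_entropy_def by (simp add: sum_nonpos)
qed

lemma AE_birkhoff_averages_continuous:
  assumes \<mu>: "\<mu> \<in> ergodic_measures T" and "finite F"
    and cont: "\<And>f. f \<in> F \<Longrightarrow> continuous_on {0..1} f"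
  shows "AE x in \<mu>. \<forall>f\<in>F. (\<lambda>n. (\<Sum>i<n. f ((T ^^ i) x)) / real n) \<longlonglongrightarrow> integral\<^sup>L \<mu> (f :: real \<Rightarrow> real)"
  using \<open>finite F\<close>
proof (rule AE_finite_allI)
  fix f assume "f \<in> F"
  have prob: "prob_space \<mu>" and sets: "sets \<mu> = sets unit_borel" and mp: "measure_preserving \<mu> T"
    and erg: "ergodic \<mu> T"
    using \<mu> by (auto simp: ergodic_measures_def invariant_measures_def prob_measures_def)
  have space: "space \<mu> = {0..1}" using sets_eq_imp_space_eq[OF sets] by (simp add: space_restrict_space)
  have T: "T \<in> \<mu> \<rightarrow>\<^sub>M \<mu>" using mp by (simp add: measure_preserving_def)
  have f: "f \<in> borel_measurable \<mu>"
    unfolding measurable_cong_sets[OF sets refl] using cont[OF \<open>f \<in> F\<close>]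
    by (rule borel_measurable_continuous_on_restrict)
  have "compact (f ` {0..1})" using cont[OF \<open>f \<in> F\<close>] by (intro compact_continuous_image) auto
  then obtain C where C: "\<And>x. x \<in> {0..1} \<Longrightarrow> \<bar>f x\<bar> \<le> C"
    using compact_imp_bounded bounded_iff by (metis imageI real_norm_def)
  \<comment> \<open>The ergodic theorem is stated with a bound on the whole type, whereas
    \<open>f\<close> is bounded on the unit interval only.\<close>
  define g where "g x = (if x \<in> {0..1} then f x else 0)" for x
  have g_f: "g x = f x" if "x \<in> space \<mu>" for x using that by (simp add: g_def space)
  have "AE x in \<mu>. (\<lambda>n. (\<Sum>i<n. g ((T ^^ i) x)) / real n) \<longlonglongrightarrow> integral\<^sup>L \<mu> g"
  proof (rule birkhoff_ergodic[OF prob mp erg])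
    show "g \<in> borel_measurable \<mu>" using f g_f by (simp cong: measurable_cong)
    show "\<bar>g x\<bar> \<le> \<bar>C\<bar>" for x using C[of x] by (auto simp: g_def)
  qed
  then show "AE x in \<mu>. (\<lambda>n. (\<Sum>i<n. f ((T ^^ i) x)) / real n) \<longlonglongrightarrow> integral\<^sup>L \<mu> f"
    using AE_space
  proof eventually_elim
    case (elim x)
    have "integral\<^sup>L \<mu> g = integral\<^sup>L \<mu> f" using g_f by (intro Bochner_Integration.integral_cong) auto
    then show ?case using elim(1) g_f funpow_in_space[OF T elim(2)] by simp
  qed
qed

lemma entropy_tendsto_0_of_no_periodic_approximation:
  fixes F :: "(real \<Rightarrow> real) set"
  assumes T: "piecewise_monotonic T" and \<mu>: "\<mu> \<in> ergodic_measures T" and F: "finite F"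
    and cont: "\<And>f. f \<in> F \<Longrightarrow> continuous_on {0..1} f" and e: "e > 0"
    and none: "\<And>p n. \<lbrakk>p \<in> {0..1}; 0 < n; (T ^^ n) p = p\<rbrakk> \<Longrightarrow>
      \<exists>f\<in>F. e \<le> \<bar>(\<Sum>i<n. f ((T ^^ i) p)) / real n - integral\<^sup>L \<mu> f\<bar>"
    and P: "finite_measurable_partition \<mu> P"
  shows "(\<lambda>n. partition_entropy \<mu> (iterated_join \<mu> T P n) / real n) \<longlonglongrightarrow> 0"
proof -
  have prob: "prob_space \<mu>" and sets: "sets \<mu> = sets unit_borel" and mp: "measure_preserving \<mu> T"
    using \<mu> by (auto simp: ergodic_measures_def invariant_measures_def prob_measures_def)
  have space: "space \<mu> = {0..1}" using sets_eq_imp_space_eq[OF sets] by (simp add: space_restrict_space)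
  have nonneg: "0 \<le> partition_entropy \<mu> (iterated_join \<mu> T P n) / real n" for n
    using partition_entropy_nonneg[OF prob] by simp
  have modulus: "\<exists>d>0. \<forall>y\<in>{0..1}. \<forall>z\<in>{0..1}. \<bar>y - z\<bar> < d \<longrightarrow> \<bar>f y - f z\<bar> \<le> e / 2" if "f \<in> F" for f
  proof -
    have "uniformly_continuous_on {0..1} f" using cont[OF that] by (intro compact_uniformly_continuous) auto
    then obtain d where "d > 0" "\<forall>x\<in>{0..1}. \<forall>x'\<in>{0..1}. dist x' x < d \<longrightarrow> dist (f x') (f x) < e / 2"
      unfolding uniformly_continuous_on_def using e by (meson half_gt_zero)
    then show ?thesis by (intro exI[of _ d]) (auto simp: dist_real_def intro: less_imp_le)
  qed
  then obtain d where d: "\<And>f. f \<in> F \<Longrightarrow> d f > 0"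
    "\<And>f y z. \<lbrakk>f \<in> F; y \<in> {0..1}; z \<in> {0..1}; \<bar>y - z\<bar> < d f\<rbrakk> \<Longrightarrow> \<bar>f y - f z\<bar> \<le> e / 2" by metis
  define \<delta>0 where "\<delta>0 = Min (insert 1 (d ` F))"
  have \<delta>0: "\<delta>0 > 0" "\<And>f. f \<in> F \<Longrightarrow> \<delta>0 \<le> d f"
    unfolding \<delta>0_def using F d(1) by (auto simp: Min_gr_iff)
  have small: "\<forall>\<^sub>F n in sequentially. partition_entropy \<mu> (iterated_join \<mu> T P n) / real n < r" if r: "r > 0" for r
  proof -
    \<comment> \<open>\<eta> makes the cost \<open>- ln (1 - \<eta>)\<close> equal to
      \<open>r / 4\<close>; with \<eta> fixed, \<beta> keeps the cost of misread cells within
      another \<open>r / 4\<close>. The word count takes a third quarter.\<close>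
    define \<eta> where "\<eta> = 1 - exp (- r / 4)"
    have \<eta>: "0 < \<eta>" "\<eta> < 1" "- ln (1 - \<eta>) = r / 4" using r by (auto simp: \<eta>_def)
    define L where "L = \<bar>ln (real (card P) / \<eta>)\<bar>"
    define \<beta> where "\<beta> = r / (4 * (L + 1))"
    have "L \<ge> 0" by (simp add: L_def)
    then have \<beta>: "\<beta> > 0" "\<beta> * L \<le> r / 4" using r by (auto simp: \<beta>_def field_simps)
    obtain E \<delta>1 where E: "E \<in> sets \<mu>" "measure \<mu> E < \<beta>" "\<delta>1 > 0"
      "\<And>y z. \<lbrakk>y \<in> space \<mu> - E; z \<in> space \<mu> - E; \<bar>y - z\<bar> < \<delta>1\<rbrakk> \<Longrightarrow> cell_of P y = cell_of P z"
      using partition_locally_constant[OF prob sets P \<beta>(1)] by metis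
    obtain S where S: "coded_interval_map T S"
      and mesh: "\<And>y z. \<lbrakk>y \<in> {0..1}; z \<in> {0..1}; coded_interval_map.code S y = coded_interval_map.code S z\<rbrakk>
        \<Longrightarrow> \<bar>y - z\<bar> < min \<delta>0 \<delta>1"
      using piecewise_monotonic_coding[OF T, of "min \<delta>0 \<delta>1"] \<delta>0(1) E(3) by (metis min_less_iff_conj)
    interpret coded_interval_map T S by (rule S)
    \<comment> \<open>Any representative outside \<open>E\<close> will do, since two of them with
      the same code are closer than \<open>\<delta>1\<close> and so share their cell.\<close>
    define \<phi> where "\<phi> q = cell_of P (SOME y. y \<in> space \<mu> - E \<and> code y = q)" for q
    have \<phi>: "cell_of P x = \<phi> (code x)" if x: "x \<in> space \<mu> - E" for x
    proof -
      define y where "y = (SOME y. y \<in> space \<mu> - E \<and> code y = code x)"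
      have y: "y \<in> space \<mu> - E \<and> code y = code x"
        unfolding y_def by (rule someI[of _ x]) (use x in simp)
      have "\<bar>x - y\<bar> < \<delta>1" using mesh[of x y] x y space by auto
      then show ?thesis unfolding \<phi>_def y_def[symmetric] using E(4) x y by blast
    qed
    have "AE x in \<mu>. \<forall>f\<in>F. (\<lambda>n. (\<Sum>i<n. f ((T ^^ i) x)) / real n) \<longlonglongrightarrow> integral\<^sup>L \<mu> f"
      using \<mu> F cont by (rule AE_birkhoff_averages_continuous)
    then have rare: "AE x in \<mu>. finite {n. splits n (n + m) x}" for m
      using AE_space
    proof eventually_elim
      case (elim x)
      show ?case
      proof (rule ccontr)
        assume inf: "infinite {n. splits n (n + m) x}"
        have x: "x \<in> {0..1}" using elim(2) space by simp
        have avg: "(\<lambda>n. (\<Sum>i<n. f ((T ^^ i) x)) / real n) \<longlonglongrightarrow> integral\<^sup>L \<mu> f" if "f \<in> F" for f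
          using elim(1) that by blast
        have mesh': "\<bar>f y - f z\<bar> \<le> e / 2"
          if "f \<in> F" "y \<in> {0..1}" "z \<in> {0..1}" "code y = code z" for f y z
          using mesh[OF that(2-4)] \<delta>0(2)[OF that(1)] by (intro d(2) that) auto
        obtain p n where p: "p \<in> {0..1}" "0 < n" "(T ^^ n) p = p"
          and close: "\<And>f. f \<in> F \<Longrightarrow> \<bar>(\<Sum>i<n. f ((T ^^ i) p)) / real n - integral\<^sup>L \<mu> f\<bar> < e"
          by (rule periodic_point_of_infinitely_many_splits[where l = "integral\<^sup>L \<mu>", OF x inf F e])
            (erule avg, erule (3) mesh', rule that)
        show False using none[OF p] close by (meson not_le)
      qed
    qed
    have "\<forall>\<^sub>F n in sequentially. partition_entropy \<mu> (iterated_join \<mu> T P n) / real n \<le>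
        r / 4 + (- ln (1 - \<eta>) + measure \<mu> E * ln (real (card P) / \<eta>))"
      using r by (intro eventually_partition_entropy_le[OF prob sets mp P rare _ \<eta>(1,2) E(1) \<phi>]) auto
    then show ?thesis
    proof eventually_elim
      case (elim n)
      have "measure \<mu> E * ln (real (card P) / \<eta>) \<le> measure \<mu> E * L"
        by (intro mult_left_mono) (auto simp: L_def)
      also have "\<dots> \<le> \<beta> * L" using E(2) \<open>L \<ge> 0\<close> by (intro mult_right_mono) auto
      finally show ?case using elim \<eta>(3) \<beta>(2) r by linarith
    qed
  qed
  show ?thesis
  proof (rule order_tendstoI)
    fix a :: real assume "a < 0"
    then show "\<forall>\<^sub>F n in sequentially. a < partition_entropy \<mu> (iterated_join \<mu> T P n) / real n"
      using nonneg by (intro always_eventually allI) (rule less_le_trans)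
  qed (rule small)
qed

theorem theoremA:
  fixes T :: "real \<Rightarrow> real" and \<mu> :: "real measure"
  assumes "piecewise_monotonic T"
    and "transitive_map T"
    and "\<mu> \<in> ergodic_measures T"
    and "metric_entropy \<mu> T > 0"
  shows "\<mu> \<in> weak_star_topology closure_of periodic_measures T"
proof (rule in_weak_star_closure_ofI)
  show "\<mu> \<in> prob_measures"
    using assms(3) by (simp add: ergodic_measures_def invariant_measures_def)
  fix F :: "(real \<Rightarrow> real) set" and e :: real
  assume F: "finite F" "\<And>f. f \<in> F \<Longrightarrow> continuous_on {0..1} f" and e: "0 < e"
  have T_unit: "(T ^^ j) p \<in> {0..1}" if "p \<in> {0..1}" for j p
    using assms(1) that funpow_in_space[of T unit_borel p j]
    by (simp add: piecewise_monotonic_def space_restrict_space)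
  show "\<exists>\<nu>\<in>periodic_measures T \<inter> prob_measures. \<forall>f\<in>F. \<bar>integral\<^sup>L \<nu> f - integral\<^sup>L \<mu> f\<bar> < e"
  proof (rule ccontr)
    assume none: "\<not> ?thesis"
    \<comment> \<open>A neighbourhood free of periodic measures means that every periodic orbit
      misses the mean of some test function by at least \<open>e\<close>, and then every partition
      has entropy 0.\<close>
    have "\<exists>f\<in>F. e \<le> \<bar>(\<Sum>i<n. f ((T ^^ i) p)) / real n - integral\<^sup>L \<mu> f\<bar>"
      if p: "p \<in> {0..1}" "0 < n" "(T ^^ n) p = p" for p n
    proof -
      have "orbit_measure T n p \<in> periodic_measures T \<inter> prob_measures"
        using orbit_measure_periodic[OF T_unit p(2)] orbit_measure_prob[OF T_unit p(2)] p by blast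
      then obtain f where f: "f \<in> F" "e \<le> \<bar>integral\<^sup>L (orbit_measure T n p) f - integral\<^sup>L \<mu> f\<bar>"
        using none by (meson not_le)
      moreover have "f \<in> borel_measurable unit_borel"
        using F(2)[OF f(1)] by (rule borel_measurable_continuous_on_restrict)
      ultimately show ?thesis using integral_orbit_measure[OF T_unit[OF p(1)] p(2)] by metis
    qed
    then have "(\<lambda>n. partition_entropy \<mu> (iterated_join \<mu> T P n) / real n) \<longlonglongrightarrow> 0"
      if "finite_measurable_partition \<mu> P" for P
      using entropy_tendsto_0_of_no_periodic_approximation[OF assms(1,3) F e _ that] by blast
    then have "lim (\<lambda>n. partition_entropy \<mu> (iterated_join \<mu> T P n) / real n) = 0"
      if "finite_measurable_partition \<mu> P" for P
      using that by (intro limI) blast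
    then have "metric_entropy \<mu> T \<le> 0"
      unfolding metric_entropy_def by (intro SUP_least) simp
    then show False using assms(4) by simp
  qed
qed

end
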